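(* Let $(M,g,J)$ be an almost hermitian manifold of real dimension $2n$ with Kähler form $\Omega(X,Y)=g(X,JY)$. Then for each $k$ the form $\phi_k=\frac{1}{k!}\Omega^k$ is a generalized calibration of degree $2k$ on $M$, and its contact set at every point $p\in M$ is $Gr(k,\mathbb C^n)$, i.e. it is the set of $J$-invariant (complex) $k$-dimensional subspaces of $T_pM\cong\mathbb C^n$, suitably oriented.
   Context: An almost hermitian manifold is a Riemannian manifold with an almost complex structure $J$ satisfying $g(JX,JY)=g(X,Y)$; $\Omega$ need not be closed. A generalized calibration of degree $m$ on an oriented Riemannian manifold $M$ is an $m$-form $\phi$ (not necessarily closed) such that $\phi(\xi)|_p\le 1$ for every $p\in M$ and every oriented $m$-plane $\xi$ in $T_pM$, where $\phi(\xi)$ denotes $\phi$ evaluated on an oriented orthonormal basis of $\xi$. The contact set of $\phi$ at $p$ is the set of oriented $m$-planes $\xi\subset T_pM$ with $\phi(\xi)=1$. *)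

theory Defs
  imports
    "HOL-Analysis.Analysis"
    "HOL-Library.Function_Algebras"
    "Jordan_Normal_Form.Determinant"
begin

text \<open>
  For open \<open>S\<close> in a finite-dimensional space, \<open>Ck_on k f S\<close> says that \<open>f\<close> is \<open>k\<close> times
  continuously differentiable on \<open>S\<close>: all iterated directional derivatives of order at most \<open>k\<close>
  exist and are continuous.
\<close>

primrec Ck_on ::
  "nat \<Rightarrow> ('b::euclidean_space \<Rightarrow> 'c::real_normed_vector) \<Rightarrow> 'b set \<Rightarrow> bool"
where
  "Ck_on 0 f S \<longleftrightarrow> continuous_on S f"
| "Ck_on (Suc k) f S \<longleftrightarrow>
     (\<forall>x\<in>S. f differentiable (at x)) \<and>
     (\<forall>v. Ck_on k (\<lambda>x. frechet_derivative f (at x) v) S)"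

definition smooth_on :: "('b::euclidean_space \<Rightarrow> 'c::real_normed_vector) \<Rightarrow> 'b set \<Rightarrow> bool" where
  "smooth_on f S \<longleftrightarrow> (\<forall>k. Ck_on k f S)"

definition ordered_basis :: "'v::real_vector set \<Rightarrow> 'v list \<Rightarrow> bool" where
  "ordered_basis V bs \<longleftrightarrow> distinct bs \<and> independent (set bs) \<and> span (set bs) = V"

definition change_of_basis :: "'v::real_vector list \<Rightarrow> 'v list \<Rightarrow> real mat" where
  "change_of_basis bs cs =
     Matrix.mat (length bs) (length bs) (\<lambda>(i, j). representation (set bs) (cs ! i) (bs ! j))"

text \<open>
  An orientation of a finite-dimensional space is an equivalence class of ordered bases;
  \<open>orientation_of bs\<close> is the class of \<open>bs\<close> as an ordered basis of its span.
\<close>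

definition orientation_of :: "'v::real_vector list \<Rightarrow> 'v list set" where
  "orientation_of bs =
     {cs. ordered_basis (span (set bs)) cs \<and> Determinant.det (change_of_basis bs cs) > 0}"

definition oriented_planes ::
  "'v::real_vector set \<Rightarrow> nat \<Rightarrow> ('v set \<times> 'v list set) set"
where
  "oriented_planes T m =
     {(V, orientation_of bs) | V bs. V \<subseteq> T \<and> ordered_basis V bs \<and> length bs = m}"

text \<open>An \<open>m\<close>-form on a subspace \<open>T\<close> is a function on lists; only its values on lists of
  length \<open>m\<close> with entries in \<open>T\<close> matter.\<close>

definition alternating_form ::
  "'v::real_vector set \<Rightarrow> nat \<Rightarrow> ('v list \<Rightarrow> real) \<Rightarrow> bool"
where
  "alternating_form T m \<alpha> \<longleftrightarrow>
     (\<forall>vs. length vs = m \<and> set vs \<subseteq> T \<longrightarrow>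
        (\<forall>i<m. \<forall>x\<in>T. \<forall>y\<in>T. \<forall>a b.
           \<alpha> (vs[i := a *\<^sub>R x + b *\<^sub>R y]) = a * \<alpha> (vs[i := x]) + b * \<alpha> (vs[i := y])) \<and>
        (\<forall>i<m. \<forall>j<m. i \<noteq> j \<and> vs ! i = vs ! j \<longrightarrow> \<alpha> vs = 0))"

text \<open>
  The exterior product of a \<open>p\<close>-form and a \<open>q\<close>-form, normalised so that the product of the
  members of a dual basis has value 1 on the basis (the determinant convention).
\<close>

definition wedge ::
  "nat \<Rightarrow> nat \<Rightarrow> ('v list \<Rightarrow> real) \<Rightarrow> ('v list \<Rightarrow> real) \<Rightarrow> 'v list \<Rightarrow> real"
where
  "wedge p q \<alpha> \<beta> vs =
     (\<Sum>\<sigma> | \<sigma> permutes {..<p + q}.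
        of_int (sign \<sigma>) * \<alpha> (map (\<lambda>i. vs ! \<sigma> i) [0..<p])
                        * \<beta> (map (\<lambda>i. vs ! \<sigma> i) [p..<p + q])) / (fact p * fact q)"

primrec wedge_power :: "nat \<Rightarrow> ('v list \<Rightarrow> real) \<Rightarrow> nat \<Rightarrow> 'v list \<Rightarrow> real" where
  "wedge_power d \<alpha> 0 = (\<lambda>vs. 1)"
| "wedge_power d \<alpha> (Suc k) = wedge d (d * k) \<alpha> (wedge_power d \<alpha> k)"

type_synonym ('a, 'e) chart = "'a set \<times> ('a \<Rightarrow> 'e)"

definition is_chart :: "'a topology \<Rightarrow> ('a, 'e::euclidean_space) chart \<Rightarrow> bool" where
  "is_chart X c \<longleftrightarrow>
     openin X (fst c) \<and> open (snd c ` fst c) \<and>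
     homeomorphic_map (subtopology X (fst c)) (top_of_set (snd c ` fst c)) (snd c)"

definition chart_inv :: "('a, 'e) chart \<Rightarrow> 'e \<Rightarrow> 'a" where
  "chart_inv c = inv_into (fst c) (snd c)"

locale smooth_manifold =
  fixes X :: "'a topology" and A :: "('a, 'e::euclidean_space) chart set"
  assumes hausdorff: "Hausdorff_space X"
    and second_countable:
      "\<exists>B. countable B \<and> (\<forall>W\<in>B. openin X W) \<and>
           (\<forall>U x. openin X U \<and> x \<in> U \<longrightarrow> (\<exists>W\<in>B. x \<in> W \<and> W \<subseteq> U))"
    and charts: "\<And>c. c \<in> A \<Longrightarrow> is_chart X c"
    and cover: "(\<Union>c\<in>A. fst c) = topspace X"
    and compatible: "\<And>c c'. c \<in> A \<Longrightarrow> c' \<in> A \<Longrightarrow>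
      smooth_on (snd c' \<circ> chart_inv c) (snd c ` (fst c \<inter> fst c'))"

instantiation "fun" :: (type, real_vector) real_vector
begin

definition "scaleR r f = (\<lambda>x. r *\<^sub>R f x)"

instance
  by standard (auto simp: scaleR_fun_def fun_eq_iff algebra_simps)

end

text \<open>
  A tangent vector at \<open>p\<close> is a family of coordinate vectors, one for each chart around \<open>p\<close>,
  related by the Jacobians of the coordinate changes. The components at all other pairs are
  set to 0, so that tangent vectors with the same coordinates are equal. Thus \<open>coord_vec A c p w\<close>
  below is the tangent vector at \<open>p\<close> whose coordinate vector in the chart \<open>c\<close> is \<open>w\<close>.
\<close>

type_synonym ('a, 'e) tvec = "('a, 'e) chart \<Rightarrow> 'e"

definition transition_deriv ::
  "'a \<Rightarrow> ('a, 'e::euclidean_space) chart \<Rightarrow> ('a, 'e) chart \<Rightarrow> 'e \<Rightarrow> 'e"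
where
  "transition_deriv p c c' = frechet_derivative (snd c' \<circ> chart_inv c) (at (snd c p))"

definition tangent_space ::
  "('a, 'e::euclidean_space) chart set \<Rightarrow> 'a \<Rightarrow> ('a, 'e) tvec set"
where
  "tangent_space A p =
     {v. (\<forall>c\<in>A. \<forall>c'\<in>A. p \<in> fst c \<and> p \<in> fst c' \<longrightarrow> v c' = transition_deriv p c c' (v c)) \<and>
         (\<forall>c. c \<notin> A \<or> p \<notin> fst c \<longrightarrow> v c = 0)}"

definition coord_vec ::
  "('a, 'e::euclidean_space) chart set \<Rightarrow> ('a, 'e) chart \<Rightarrow> 'a \<Rightarrow> 'e \<Rightarrow> ('a, 'e) tvec"
where
  "coord_vec A c p w =
     (\<lambda>c'. if c' \<in> A \<and> p \<in> fst c' then transition_deriv p c c' w else 0)"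

definition differential_form ::
  "'a topology \<Rightarrow> ('a, 'e::euclidean_space) chart set \<Rightarrow> nat \<Rightarrow>
   ('a \<Rightarrow> ('a, 'e) tvec list \<Rightarrow> real) \<Rightarrow> bool"
where
  "differential_form X A m \<phi> \<longleftrightarrow>
     (\<forall>p\<in>topspace X. alternating_form (tangent_space A p) m (\<phi> p)) \<and>
     (\<forall>c\<in>A. \<forall>ws. length ws = m \<longrightarrow>
        smooth_on (\<lambda>y. \<phi> (chart_inv c y) (map (coord_vec A c (chart_inv c y)) ws))
                  (snd c ` fst c))"

locale riemannian_manifold = smooth_manifold X A
  for X :: "'a topology" and A :: "('a, 'e::euclidean_space) chart set" +
  fixes g :: "'a \<Rightarrow> ('a, 'e) tvec \<Rightarrow> ('a, 'e) tvec \<Rightarrow> real"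
  assumes metric_linear:
      "\<And>p u v w a b. p \<in> topspace X \<Longrightarrow> u \<in> tangent_space A p \<Longrightarrow>
         v \<in> tangent_space A p \<Longrightarrow> w \<in> tangent_space A p \<Longrightarrow>
         g p (a *\<^sub>R u + b *\<^sub>R v) w = a * g p u w + b * g p v w"
    and metric_sym:
      "\<And>p v w. p \<in> topspace X \<Longrightarrow> v \<in> tangent_space A p \<Longrightarrow> w \<in> tangent_space A p \<Longrightarrow>
         g p v w = g p w v"
    and metric_pos:
      "\<And>p v. p \<in> topspace X \<Longrightarrow> v \<in> tangent_space A p \<Longrightarrow> v \<noteq> 0 \<Longrightarrow> g p v v > 0"
    and metric_smooth:
      "\<And>c u w. c \<in> A \<Longrightarrow>
         smooth_on (\<lambda>y. g (chart_inv c y) (coord_vec A c (chart_inv c y) u)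
                                          (coord_vec A c (chart_inv c y) w)) (snd c ` fst c)"

locale almost_complex_manifold = smooth_manifold X A
  for X :: "'a topology" and A :: "('a, 'e::euclidean_space) chart set" +
  fixes J :: "'a \<Rightarrow> ('a, 'e) tvec \<Rightarrow> ('a, 'e) tvec"
  assumes J_closed:
      "\<And>p v. p \<in> topspace X \<Longrightarrow> v \<in> tangent_space A p \<Longrightarrow> J p v \<in> tangent_space A p"
    and J_linear:
      "\<And>p v w a b. p \<in> topspace X \<Longrightarrow> v \<in> tangent_space A p \<Longrightarrow> w \<in> tangent_space A p \<Longrightarrow>
         J p (a *\<^sub>R v + b *\<^sub>R w) = a *\<^sub>R J p v + b *\<^sub>R J p w"
    and J_squared:
      "\<And>p v. p \<in> topspace X \<Longrightarrow> v \<in> tangent_space A p \<Longrightarrow> J p (J p v) = - v"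
    and J_smooth:
      "\<And>c w. c \<in> A \<Longrightarrow>
         smooth_on (\<lambda>y. J (chart_inv c y) (coord_vec A c (chart_inv c y) w) c) (snd c ` fst c)"

locale almost_hermitian_manifold =
  riemannian_manifold X A g + almost_complex_manifold X A J
  for X :: "'a topology" and A :: "('a, 'e::euclidean_space) chart set"
    and g :: "'a \<Rightarrow> ('a, 'e) tvec \<Rightarrow> ('a, 'e) tvec \<Rightarrow> real"
    and J :: "'a \<Rightarrow> ('a, 'e) tvec \<Rightarrow> ('a, 'e) tvec" +
  assumes hermitian:
    "\<And>p v w. p \<in> topspace X \<Longrightarrow> v \<in> tangent_space A p \<Longrightarrow> w \<in> tangent_space A p \<Longrightarrow>
       g p (J p v) (J p w) = g p v w"

text \<open>
  An orientation of the manifold is an orientation of every tangent space that is locally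
  constant with respect to coordinate frames. As every ordered basis \<open>ws\<close> of the model space is
  considered, the frames of the opposite orientation are covered by the same condition.
\<close>

locale oriented_riemannian_manifold = riemannian_manifold X A g
  for X :: "'a topology" and A :: "('a, 'e::euclidean_space) chart set"
    and g :: "'a \<Rightarrow> ('a, 'e) tvec \<Rightarrow> ('a, 'e) tvec \<Rightarrow> real" +
  fixes Or :: "'a \<Rightarrow> ('a, 'e) tvec list set"
  assumes orientation_pointwise:
      "\<And>p. p \<in> topspace X \<Longrightarrow>
         \<exists>bs. ordered_basis (tangent_space A p) bs \<and> Or p = orientation_of bs"
    and orientation_continuous:
      "\<And>c ws. c \<in> A \<Longrightarrow> ordered_basis UNIV ws \<Longrightarrow>
         openin X {p \<in> fst c. map (coord_vec A c p) ws \<in> Or p}"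

definition orthonormal :: "('v \<Rightarrow> 'v \<Rightarrow> real) \<Rightarrow> 'v list \<Rightarrow> bool" where
  "orthonormal h bs \<longleftrightarrow>
     (\<forall>i<length bs. \<forall>j<length bs. h (bs ! i) (bs ! j) = (if i = j then 1 else 0))"

text \<open>\<open>plane_value h \<alpha> \<xi>\<close> is \<open>\<alpha>(\<xi>)\<close>; the choice of the oriented orthonormal basis is immaterial.\<close>

definition plane_value ::
  "('v \<Rightarrow> 'v \<Rightarrow> real) \<Rightarrow> ('v list \<Rightarrow> real) \<Rightarrow> 'v set \<times> 'v list set \<Rightarrow> real"
where
  "plane_value h \<alpha> \<xi> = \<alpha> (SOME bs. bs \<in> snd \<xi> \<and> orthonormal h bs)"

definition generalized_calibration ::
  "'a topology \<Rightarrow> ('a, 'e::euclidean_space) chart set \<Rightarrow>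
   ('a \<Rightarrow> ('a, 'e) tvec \<Rightarrow> ('a, 'e) tvec \<Rightarrow> real) \<Rightarrow> ('a \<Rightarrow> ('a, 'e) tvec list set) \<Rightarrow>
   nat \<Rightarrow> ('a \<Rightarrow> ('a, 'e) tvec list \<Rightarrow> real) \<Rightarrow> bool"
where
  "generalized_calibration X A g Or m \<phi> \<longleftrightarrow>
     oriented_riemannian_manifold X A g Or \<and> differential_form X A m \<phi> \<and>
     (\<forall>p\<in>topspace X. \<forall>\<xi>\<in>oriented_planes (tangent_space A p) m. plane_value (g p) (\<phi> p) \<xi> \<le> 1)"

definition contact_set ::
  "('a, 'e::euclidean_space) chart set \<Rightarrow> ('a \<Rightarrow> ('a, 'e) tvec \<Rightarrow> ('a, 'e) tvec \<Rightarrow> real) \<Rightarrow>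
   nat \<Rightarrow> ('a \<Rightarrow> ('a, 'e) tvec list \<Rightarrow> real) \<Rightarrow> 'a \<Rightarrow>
   (('a, 'e) tvec set \<times> ('a, 'e) tvec list set) set"
where
  "contact_set A g m \<phi> p =
     {\<xi> \<in> oriented_planes (tangent_space A p) m. plane_value (g p) (\<phi> p) \<xi> = 1}"

definition complex_scale :: "('v::real_vector \<Rightarrow> 'v) \<Rightarrow> complex \<Rightarrow> 'v \<Rightarrow> 'v" where
  "complex_scale J z v = Re z *\<^sub>R v + Im z *\<^sub>R J v"

definition complex_basis :: "('v::real_vector \<Rightarrow> 'v) \<Rightarrow> 'v set \<Rightarrow> 'v list \<Rightarrow> bool" where
  "complex_basis J V es \<longleftrightarrow> set es \<subseteq> V \<and>
     (\<forall>v\<in>V. \<exists>!zs. length zs = length es \<and> v = (\<Sum>i<length es. complex_scale J (zs ! i) (es ! i)))"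

definition complex_grassmannian ::
  "('v::real_vector \<Rightarrow> 'v) \<Rightarrow> 'v set \<Rightarrow> nat \<Rightarrow> 'v set set"
where
  "complex_grassmannian J T k =
     {V. subspace V \<and> V \<subseteq> T \<and> J ` V \<subseteq> V \<and> (\<exists>es. length es = k \<and> complex_basis J V es)}"

text \<open>
  The orientation of a complex subspace given by the real bases \<open>(J e\<^sub>1, e\<^sub>1, \<dots>, J e\<^sub>k, e\<^sub>k)\<close> with
  \<open>(e\<^sub>1, \<dots>, e\<^sub>k)\<close> a complex basis. With the convention \<open>\<Omega>(X, Y) = g(X, J Y)\<close> one has
  \<open>\<Omega>(J e, e) = g(J e, J e) > 0\<close>, so this is the orientation adapted to \<open>\<Omega>\<close>; it differs from that
  of \<open>(e\<^sub>1, J e\<^sub>1, \<dots>, e\<^sub>k, J e\<^sub>k)\<close> by the sign \<open>(-1)\<^sup>k\<close>. The union is over equal orientations, since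
  complex changes of basis have positive real determinant.
\<close>

definition complex_orientation :: "('v::real_vector \<Rightarrow> 'v) \<Rightarrow> 'v set \<Rightarrow> 'v list set" where
  "complex_orientation J V =
     (\<Union>es\<in>{es. complex_basis J V es}. orientation_of (concat (map (\<lambda>e. [J e, e]) es)))"

definition kaehler_form :: "('a \<Rightarrow> 'v \<Rightarrow> 'v \<Rightarrow> real) \<Rightarrow> ('a \<Rightarrow> 'v \<Rightarrow> 'v) \<Rightarrow> 'a \<Rightarrow> 'v list \<Rightarrow> real" where
  "kaehler_form g J p vs = g p (vs ! 0) (J p (vs ! 1))"

definition kaehler_power ::
  "('a \<Rightarrow> 'v \<Rightarrow> 'v \<Rightarrow> real) \<Rightarrow> ('a \<Rightarrow> 'v \<Rightarrow> 'v) \<Rightarrow> nat \<Rightarrow> 'a \<Rightarrow> 'v list \<Rightarrow> real"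
where
  "kaehler_power g J k p vs = wedge_power 2 (kaehler_form g J p) k vs / fact k"

end

(* Every value of \<Omega>^k / k! on an orthonormal family is at most 1 in absolute value, by induction on k: in the
   real span V of the family take a unit vector u and let w be a unit vector in the direction of the
   projection of J u to V. After completing u, w to an orthonormal basis u, w, w_3, ..., w_2k of V, the covector
   \<Omega>(u, _) vanishes on all w_i, so the value splits, up to sign, as g(J u, w) times the value of
   \<Omega>^(k-1) / (k-1)! on w_3, ..., w_2k. Equality forces g(J u, w) = 1 or -1 and hence J u in V for every u in V.
   Conversely V has a unitary basis when it is J-invariant, and there the value is 1.
   Orientations are handled through the form itself: on a complex subspace of complex dimension k the complex
   orientation consists of exactly the ordered bases on which \<Omega>^k is positive. This also makes the complex
   orientation of the manifold continuous. *)

theory Submission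
  imports Defs
begin

subsection \<open>Alternating forms and determinants\<close>

text \<open>The recursion for \<open>wedge_power\<close> nests one permutation sum inside another
  and singles out the first factor, which hides the symmetry among the \<open>k\<close> factors. The
  closed form \<open>pairing_sum\<close>, a Pfaffian up to a constant, restores it: it can be
  expanded along a row, and multilinearity and smoothness can be read off each product. Splitting
  off \<open>u\<close> and \<open>w\<close> is then a Pfaffian expansion along a row with a single
  nonzero entry. Two choices have to be controlled: \<open>plane_value\<close> picks an unknown
  orthonormal basis, and \<open>complex_orientation\<close> is a union over all complex bases. Both
  are governed by one fact: the values of a form on two bases of \<open>V\<close> differ by the
  determinant of the change of basis, which is 1 or -1 between orthonormal bases. For complex bases
  that are not unitary the sign is found by complex Gram-Schmidt, not by computing the real
  determinant of a complex matrix.\<close>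

lemma map_upt_fun_upd: "i < m \<Longrightarrow> (map f [0..<m])[i := x] = map (f(i := x)) [0..<m]"
  by (rule nth_equalityI) (auto simp: nth_list_update)

text \<open>Writing argument lists as maps over \<open>[0..<m]\<close> turns the update of a slot
  into a function update and a permutation of slots into a composition, the form in which the
  determinant appears.\<close>

lemma alternating_form_upd:
  assumes "alternating_form T m \<alpha>" "\<And>j. j < m \<Longrightarrow> f j \<in> T" "i < m" "x \<in> T" "y \<in> T"
  shows "\<alpha> (map (f(i := a *\<^sub>R x + b *\<^sub>R y)) [0..<m]) =
         a * \<alpha> (map (f(i := x)) [0..<m]) + b * \<alpha> (map (f(i := y)) [0..<m])"
proof -
  have "set (map f [0..<m]) \<subseteq> T" using assms(2) by auto
  then show ?thesis
    using assms unfolding alternating_form_def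
    by (metis (no_types, lifting) diff_zero length_map length_upt map_upt_fun_upd)
qed

lemma alternating_form_eq_0:
  assumes "alternating_form T m \<alpha>" "\<And>j. j < m \<Longrightarrow> f j \<in> T" "i < m" "j < m" "i \<noteq> j" "f i = f j"
  shows "\<alpha> (map f [0..<m]) = 0"
proof -
  have "set (map f [0..<m]) \<subseteq> T" using assms(2) by auto
  then show ?thesis
    using assms unfolding alternating_form_def by (auto dest!: spec[of _ "map f [0..<m]"])
qed

lemma alternating_form_sum:
  assumes "subspace T" "alternating_form T m \<alpha>" "\<And>j. j < m \<Longrightarrow> f j \<in> T" "i < m"
    and "finite S" "\<And>j. j \<in> S \<Longrightarrow> x j \<in> T"
  shows "\<alpha> (map (f(i := \<Sum>j\<in>S. c j *\<^sub>R x j)) [0..<m]) = (\<Sum>j\<in>S. c j * \<alpha> (map (f(i := x j)) [0..<m]))"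
  using assms(5,6)
proof (induction S rule: finite_induct)
  case empty
  have "0 \<in> T" using assms(1) by (simp add: subspace_0)
  then show ?case
    using alternating_form_upd[where f=f, OF assms(2,3,4), where x=0 and y=0 and a=0 and b=0] by (simp del: map_eq_conv fun_upd_apply)
next
  case (insert s S)
  have "(\<Sum>j\<in>S. c j *\<^sub>R x j) \<in> T"
    using insert.prems assms(1) by (intro subspace_sum subspace_scale) auto
  then show ?case
    using insert alternating_form_upd[where f=f, OF assms(2,3,4), where x="x s" and y="\<Sum>j\<in>S. c j *\<^sub>R x j" and a="c s" and b=1]
    by (simp del: map_eq_conv fun_upd_apply)
qed

text \<open>Induction on the number \<open>r\<close> of slots already expanded. The tail
  \<open>w\<close> is generalised because the step stores the next linear combination in slot
  \<open>r\<close> of the tail before the induction hypothesis is applied.\<close>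

lemma alternating_form_expand:
  assumes T: "subspace T" and alt: "alternating_form T m \<alpha>" and b: "\<And>j. j < m \<Longrightarrow> b j \<in> T"
    and "r \<le> m" and w: "\<And>j. j < m \<Longrightarrow> w j \<in> T"
  shows "\<alpha> (map (\<lambda>i. if i < r then \<Sum>j<m. A i j *\<^sub>R b j else w i) [0..<m]) =
    (\<Sum>f\<in>{..<r} \<rightarrow>\<^sub>E {..<m}. (\<Prod>i<r. A i (f i)) * \<alpha> (map (\<lambda>i. if i < r then b (f i) else w i) [0..<m]))"
  using \<open>r \<le> m\<close> w
proof (induction r arbitrary: w)
  case 0
  then show ?case by simp
next
  case (Suc r)
  let ?S = "\<Sum>j<m. A r j *\<^sub>R b j"
  let ?h = "\<lambda>f i. if i < r then b (f i) else w i"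
  have S: "?S \<in> T" using T b by (intro subspace_sum subspace_scale) auto
  have "map (\<lambda>i. if i < Suc r then \<Sum>j<m. A i j *\<^sub>R b j else w i) [0..<m] =
        map (\<lambda>i. if i < r then \<Sum>j<m. A i j *\<^sub>R b j else (w(r := ?S)) i) [0..<m]"
    by (auto simp: less_Suc_eq)
  then have "\<alpha> (map (\<lambda>i. if i < Suc r then \<Sum>j<m. A i j *\<^sub>R b j else w i) [0..<m]) =
     (\<Sum>f\<in>{..<r} \<rightarrow>\<^sub>E {..<m}. (\<Prod>i<r. A i (f i)) *
        \<alpha> (map (\<lambda>i. if i < r then b (f i) else (w(r := ?S)) i) [0..<m]))"
    using Suc.IH[of "w(r := ?S)"] Suc.prems S by (simp del: map_eq_conv)
  also have "\<dots> = (\<Sum>f\<in>{..<r} \<rightarrow>\<^sub>E {..<m}. \<Sum>j<m. (\<Prod>i<r. A i (f i)) * A r j *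
        \<alpha> (map ((?h f)(r := b j)) [0..<m]))"
  proof (rule sum.cong[OF refl])
    fix f assume f: "f \<in> {..<r} \<rightarrow>\<^sub>E {..<m}"
    have hT: "?h f j \<in> T" if "j < m" for j
      using that f b Suc.prems by (auto simp: PiE_iff)
    have "(\<lambda>i. if i < r then b (f i) else (w(r := ?S)) i) = (?h f)(r := ?S)"
      by auto
    then have "\<alpha> (map (\<lambda>i. if i < r then b (f i) else (w(r := ?S)) i) [0..<m]) =
       (\<Sum>j<m. A r j * \<alpha> (map ((?h f)(r := b j)) [0..<m]))"
      using alternating_form_sum[where f="?h f" and i=r and S="{..<m}" and x=b and c="A r", OF T alt hT] Suc.prems b by simp
    then show "(\<Prod>i<r. A i (f i)) * \<alpha> (map (\<lambda>i. if i < r then b (f i) else (w(r := ?S)) i) [0..<m])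
       = (\<Sum>j<m. (\<Prod>i<r. A i (f i)) * A r j * \<alpha> (map ((?h f)(r := b j)) [0..<m]))"
      by (simp add: sum_distrib_left mult.assoc)
  qed
  also have "\<dots> = (\<Sum>(j, f)\<in>{..<m} \<times> ({..<r} \<rightarrow>\<^sub>E {..<m}). (\<Prod>i<r. A i (f i)) * A r j *
        \<alpha> (map ((?h f)(r := b j)) [0..<m]))"
    unfolding sum.cartesian_product[symmetric] by (rule sum.swap)
  also have "\<dots> = (\<Sum>f\<in>{..<Suc r} \<rightarrow>\<^sub>E {..<m}. (\<Prod>i<Suc r. A i (f i)) *
        \<alpha> (map (\<lambda>i. if i < Suc r then b (f i) else w i) [0..<m]))"
  proof -
    \<comment> \<open>Index functions on \<open>{..<Suc r}\<close> correspond to pairs of a value at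
      \<open>r\<close> and an index function on \<open>{..<r}\<close>.\<close>
    have inj: "inj_on (\<lambda>(y, g). g(r := y)) ({..<m} \<times> ({..<r} \<rightarrow>\<^sub>E {..<m}))"
      using FuncSet.inj_combinator[where x=r and S="{..<r}" and T="\<lambda>_. {..<m}"] by simp
    have img: "{..<Suc r} \<rightarrow>\<^sub>E {..<m} = (\<lambda>(y, g). g(r := y)) ` ({..<m} \<times> ({..<r} \<rightarrow>\<^sub>E {..<m}))"
      by (simp add: lessThan_Suc PiE_insert_eq)
    show ?thesis
      unfolding img sum.reindex[OF inj] o_def
    proof (rule sum.cong[OF refl], clarify)
      fix j f assume f: "f \<in> {..<r} \<rightarrow>\<^sub>E {..<m}" "j < m"
      have 1: "(\<lambda>i. if i < Suc r then b ((f(r := j)) i) else w i) = (?h f)(r := b j)"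
        by auto
      show "(\<Prod>i<r. A i (f i)) * A r j * \<alpha> (map ((?h f)(r := b j)) [0..<m]) =
        (\<Prod>i<Suc r. A i ((f(r := j)) i)) *
           \<alpha> (map (\<lambda>i. if i < Suc r then b ((f(r := j)) i) else w i) [0..<m])"
        unfolding 1 by simp
    qed
  qed
  finally show ?case .
qed

text \<open>Polarisation: the form vanishes when slots \<open>i\<close> and \<open>j\<close> both
  hold \<open>b i + b j\<close>; after expansion the two terms with equal entries vanish as well,
  and the mixed terms must cancel.\<close>

lemma alternating_form_transpose:
  assumes alt: "alternating_form T m \<alpha>" and T: "subspace T" and b: "\<And>j. j < m \<Longrightarrow> b j \<in> T"
    and ij: "i < m" "j < m" "i \<noteq> j"
  shows "\<alpha> (map (b \<circ> Transposition.transpose i j) [0..<m]) = - \<alpha> (map b [0..<m])"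
proof -
  let ?F = "\<lambda>x y. \<alpha> (map (b(i := x, j := y)) [0..<m])"
  have mem: "(b(i := x)) l \<in> T" "(b(j := x)) l \<in> T" if "x \<in> T" "l < m" for x l
    using that b by auto
  have add: "?F (b i + b j) z = ?F (b i) z + ?F (b j) z" if "z \<in> T" for z
    using alternating_form_upd[where f="b(j := z)", OF alt mem(2)[OF that] ij(1) b[OF ij(1)] b[OF ij(2)], where a=1 and b=1] ij
    by (simp only: fun_upd_twist[OF ij(3)] scaleR_one mult_1)
  have s: "b i + b j \<in> T" using T b ij by (simp add: subspace_add)
  have add2: "?F z (b i + b j) = ?F z (b i) + ?F z (b j)" if "z \<in> T" for z
    using alternating_form_upd[where f="b(i := z)", OF alt mem(1)[OF that] ij(2) b[OF ij(1)] b[OF ij(2)], where a=1 and b=1] ij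
    by simp
  have zero: "?F z z = 0" if "z \<in> T" for z
    using alternating_form_eq_0[OF alt _ ij] that b ij by simp
  have "?F (b i) (b j) + ?F (b j) (b i) = 0"
    using zero[OF s] add[OF s] add2[OF b[OF ij(1)]] add2[OF b[OF ij(2)]] zero[OF b[OF ij(1)]] zero[OF b[OF ij(2)]]
    by simp
  moreover have "b \<circ> Transposition.transpose i j = b(i := b j, j := b i)"
    using ij by (auto simp: Transposition.transpose_def)
  ultimately show ?thesis by simp
qed

text \<open>Induction over a product of transpositions. The outermost transposition is absorbed into
  the family, so \<open>b\<close> has to vary.\<close>

lemma alternating_form_permute:
  assumes alt: "alternating_form T m \<alpha>" and T: "subspace T" and b: "\<And>j. j < m \<Longrightarrow> b j \<in> T"
    and "\<sigma> permutes {0..<m}"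
  shows "\<alpha> (map (b \<circ> \<sigma>) [0..<m]) = of_int (sign \<sigma>) * \<alpha> (map b [0..<m])"
  using assms(4) finite_atLeastLessThan b
proof (induction arbitrary: b rule: permutes_induct)
  case id
  then show ?case by simp
next
  case (swap i j p)
  have "\<alpha> (map ((b \<circ> Transposition.transpose i j) \<circ> p) [0..<m]) =
     of_int (sign p) * \<alpha> (map (b \<circ> Transposition.transpose i j) [0..<m])"
    using swap.prems swap.hyps by (intro swap.IH) (auto simp: Transposition.transpose_def)
  also have "\<alpha> (map (b \<circ> Transposition.transpose i j) [0..<m]) = - \<alpha> (map b [0..<m])"
    using swap by (intro alternating_form_transpose[OF alt T]) auto
  finally show ?case
    using swap.hyps permutes_imp_permutation[OF finite_atLeastLessThan swap.hyps(4)]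
      sign_compose[OF permutation_swap_id, of p i j]
    by (simp add: sign_swap_id o_assoc del: o_apply)
qed

text \<open>The Leibniz formula: after multilinear expansion every term with a repeated index
  vanishes, so only permutations survive, each with its sign.\<close>

lemma alternating_form_linear_combination:
  assumes T: "subspace T" and alt: "alternating_form T m \<alpha>" and bs: "set bs \<subseteq> T" "length bs = m"
    and A: "A \<in> carrier_mat m m"
  shows "\<alpha> (map (\<lambda>i. \<Sum>j<m. A $$ (i, j) *\<^sub>R bs ! j) [0..<m]) = Determinant.det A * \<alpha> bs"
proof -
  let ?b = "\<lambda>j. bs ! j"
  let ?P = "{\<sigma>. \<sigma> permutes {0..<m}}"
  let ?E = "{..<m} \<rightarrow>\<^sub>E {..<m}"
  let ?g = "\<lambda>f. (\<Prod>i<m. A $$ (i, f i)) * \<alpha> (map (\<lambda>i. bs ! f i) [0..<m])"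
  have b: "?b j \<in> T" if "j < m" for j using that bs by auto
  have bs_eq: "map ?b [0..<m] = bs" using bs(2) by (auto simp: map_nth)
  have "\<alpha> (map (\<lambda>i. \<Sum>j<m. A $$ (i, j) *\<^sub>R bs ! j) [0..<m]) =
      \<alpha> (map (\<lambda>i. if i < m then \<Sum>j<m. A $$ (i, j) *\<^sub>R bs ! j else 0) [0..<m])"
    by (intro arg_cong[of _ _ \<alpha>]) auto
  also have "\<dots> = (\<Sum>f\<in>?E. (\<Prod>i<m. A $$ (i, f i)) * \<alpha> (map (\<lambda>i. if i < m then bs ! f i else 0) [0..<m]))"
    using T by (intro alternating_form_expand[where r=m and w="\<lambda>_. 0" and b="\<lambda>j. bs ! j" and A="\<lambda>i j. A $$ (i, j)", OF T alt b]) (auto simp: subspace_0)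
  also have "\<dots> = (\<Sum>f\<in>?E. ?g f)"
    by (intro sum.cong arg_cong2[of _ _ _ _ "(*)"] arg_cong[of _ _ \<alpha>]) auto
  also have "\<dots> = (\<Sum>f\<in>{f\<in>?E. inj_on f {..<m}}. ?g f)"
  proof (rule sum.mono_neutral_right)
    show "\<forall>f\<in>?E - {f\<in>?E. inj_on f {..<m}}. ?g f = 0"
    proof
      fix f assume f: "f \<in> ?E - {f\<in>?E. inj_on f {..<m}}"
      then obtain i j where ij: "i < m" "j < m" "i \<noteq> j" "f i = f j"
        by (auto simp: inj_on_def)
      have "bs ! f l \<in> T" if "l < m" for l
        using f that by (intro b) (auto simp: PiE_iff)
      then show "?g f = 0"
        using alternating_form_eq_0[OF alt, of "\<lambda>i. bs ! f i" i j] ij by simp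
    qed
  qed (auto intro!: finite_PiE)
  \<comment> \<open>Extensional index functions are \<open>undefined\<close> outside
    \<open>{..<m}\<close>, permutations are the identity there; the bijection only exchanges these
    default values.\<close>
  also have "\<dots> = (\<Sum>\<sigma>\<in>?P. ?g \<sigma>)"
  proof (rule sum.reindex_bij_witness[where i = "\<lambda>\<sigma>. restrict \<sigma> {..<m}" and
        j = "\<lambda>f i. if i < m then f i else i"])
    fix f assume f: "f \<in> {f\<in>?E. inj_on f {..<m}}"
    then show "restrict (\<lambda>i. if i < m then f i else i) {..<m} = f"
      by (auto simp: fun_eq_iff PiE_iff extensional_def)
    have inj: "inj_on (\<lambda>i. if i < m then f i else i) {0..<m}"
      using f by (auto simp: inj_on_def)
    then have "bij_betw (\<lambda>i. if i < m then f i else i) {0..<m} {0..<m}"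
      unfolding bij_betw_def using f
      by (intro conjI endo_inj_surj) (auto simp: PiE_iff)
    then show "(\<lambda>i. if i < m then f i else i) \<in> ?P"
      by (auto intro!: bij_imp_permutes)
    show "?g (\<lambda>i. if i < m then f i else i) = ?g f"
      by (intro arg_cong2[of _ _ _ _ "(*)"] arg_cong[of _ _ \<alpha>] prod.cong) auto
  next
    fix \<sigma> assume s: "\<sigma> \<in> ?P"
    then show "(\<lambda>i. if i < m then restrict \<sigma> {..<m} i else i) = \<sigma>"
      by (auto simp: fun_eq_iff permutes_def)
    show "restrict \<sigma> {..<m} \<in> {f\<in>?E. inj_on f {..<m}}"
      using s permutes_in_image[of \<sigma> "{0..<m}"] permutes_inj_on[of \<sigma> "{0..<m}"]
      by (auto simp: inj_on_restrict_eq) 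
  qed
  also have "\<dots> = (\<Sum>\<sigma>\<in>?P. of_int (sign \<sigma>) * (\<Prod>i=0..<m. A $$ (i, \<sigma> i)) * \<alpha> bs)"
  proof (rule sum.cong[OF refl])
    fix \<sigma> assume "\<sigma> \<in> ?P"
    then have "\<alpha> (map (\<lambda>i. bs ! \<sigma> i) [0..<m]) = of_int (sign \<sigma>) * \<alpha> bs"
      using alternating_form_permute[where b="\<lambda>j. bs ! j" and \<sigma>=\<sigma>, OF alt T b] bs_eq by (simp add: o_def)
    then show "?g \<sigma> = of_int (sign \<sigma>) * (\<Prod>i=0..<m. A $$ (i, \<sigma> i)) * \<alpha> bs"
      by (simp add: atLeast0LessThan)
  qed
  also have "\<dots> = Determinant.det A * \<alpha> bs"
    using A by (simp add: Determinant.det_def sum_distrib_right)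
  finally show ?thesis .
qed

subsection \<open>Ordered bases and orientations\<close>

text \<open>Coefficients are indexed by position, so a single condition covers both claims: a
  repeated vector would itself give a nontrivial relation with coefficients 1 and -1.\<close>

lemma distinct_independentI:
  assumes ind: "\<And>a i. (\<Sum>i<length bs. a i *\<^sub>R bs ! i) = 0 \<Longrightarrow> i < length bs \<Longrightarrow> a i = 0"
  shows "distinct bs" "independent (set bs)"
proof -
  show dist: "distinct bs"
  proof (rule ccontr)
    assume "\<not> distinct bs"
    then obtain i j where ij: "i < length bs" "j < length bs" "i \<noteq> j" "bs ! i = bs ! j"
      by (auto simp: distinct_conv_nth)
    let ?a = "\<lambda>l. (if l = i then 1 else 0) - (if l = j then 1 else (0::real))"
    have "(\<Sum>l<length bs. ?a l *\<^sub>R bs ! l) = 0"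
      using ij by (simp add: scaleR_left_diff_distrib sum_subtractf if_distrib[of "\<lambda>c. c *\<^sub>R _"] cong: if_cong)
    from ind[OF this ij(1)] ij show False by simp
  qed
  have bij: "bij_betw ((!) bs) {..<length bs} (set bs)"
    using dist by (intro bij_betw_nth) auto
  show "independent (set bs)"
  proof
    assume "dependent (set bs)"
    then obtain u v where u: "v \<in> set bs" "u v \<noteq> 0" "(\<Sum>v\<in>set bs. u v *\<^sub>R v) = 0"
      by (auto simp: real_vector.dependent_finite)
    have "(\<Sum>i<length bs. u (bs ! i) *\<^sub>R bs ! i) = 0"
      using u(3) sum.reindex_bij_betw[OF bij, of "\<lambda>v. u v *\<^sub>R v"] by simp
    from ind[OF this] u show False by (auto simp: in_set_conv_nth)
  qed
qed

lemma ordered_basisI: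
  assumes V: "subspace V" "set bs \<subseteq> V"
    and spn: "\<And>v. v \<in> V \<Longrightarrow> \<exists>a. v = (\<Sum>i<length bs. a i *\<^sub>R bs ! i)"
    and ind: "\<And>a i. (\<Sum>i<length bs. a i *\<^sub>R bs ! i) = 0 \<Longrightarrow> i < length bs \<Longrightarrow> a i = 0"
  shows "ordered_basis V bs"
proof -
  have "span (set bs) = V"
  proof
    show "span (set bs) \<subseteq> V" using V by (rule span_minimal[rotated])
    show "V \<subseteq> span (set bs)"
    proof
      fix v assume "v \<in> V"
      then obtain a where "v = (\<Sum>i<length bs. a i *\<^sub>R bs ! i)" using spn by blast
      moreover have "(\<Sum>i<length bs. a i *\<^sub>R bs ! i) \<in> span (set bs)"
        by (rule span_sum, rule span_scale, rule span_base) simp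
      ultimately show "v \<in> span (set bs)" by simp
    qed
  qed
  then show ?thesis using distinct_independentI[of bs] ind unfolding ordered_basis_def by blast
qed

lemma ordered_basis_subspace: "ordered_basis V bs \<Longrightarrow> subspace V"
  by (auto simp: ordered_basis_def)

lemma ordered_basis_subset: "ordered_basis V bs \<Longrightarrow> set bs \<subseteq> V"
  by (auto simp: ordered_basis_def span_base)

lemma ordered_basis_length: "ordered_basis V bs \<Longrightarrow> length bs = dim V"
  using distinct_card[of bs] real_vector.dim_eq_card_independent[of "set bs"] real_vector.dim_span[of "set bs"]
  by (auto simp: ordered_basis_def)

lemma ordered_basis_expansion:
  assumes "ordered_basis V bs" "v \<in> V"
  shows "v = (\<Sum>i<length bs. representation (set bs) v (bs ! i) *\<^sub>R bs ! i)"
proof -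
  have bij: "bij_betw ((!) bs) {..<length bs} (set bs)"
    using assms by (intro bij_betw_nth) (auto simp: ordered_basis_def)
  have "v = (\<Sum>b\<in>set bs. representation (set bs) v b *\<^sub>R b)"
    using assms by (subst real_vector.sum_representation_eq) (auto simp: ordered_basis_def)
  also have "\<dots> = (\<Sum>i<length bs. representation (set bs) v (bs ! i) *\<^sub>R bs ! i)"
    using sum.reindex_bij_betw[OF bij, of "\<lambda>b. representation (set bs) v b *\<^sub>R b"] by simp
  finally show ?thesis .
qed

lemma ordered_basis_coeffs_unique:
  assumes "ordered_basis V bs" "(\<Sum>i<length bs. a i *\<^sub>R bs ! i) = (\<Sum>i<length bs. c i *\<^sub>R bs ! i)" "j < length bs"
  shows "a j = c j"
proof -
  have bij: "bij_betw ((!) bs) {..<length bs} (set bs)"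
    using assms by (intro bij_betw_nth) (auto simp: ordered_basis_def)
  \<comment> \<open>Coefficients by position become coefficients by vector through the inverse of
    the enumeration, which exists because the list is distinct.\<close>
  let ?inv = "the_inv_into {..<length bs} ((!) bs)"
  define u where "u v = a (?inv v) - c (?inv v)" for v
  have inv: "?inv (bs ! i) = i" if "i < length bs" for i
    using that bij by (simp add: bij_betw_def the_inv_into_f_f)
  have "(\<Sum>v\<in>set bs. u v *\<^sub>R v) = (\<Sum>i<length bs. (a i - c i) *\<^sub>R bs ! i)"
    unfolding sum.reindex_bij_betw[OF bij, of "\<lambda>v. u v *\<^sub>R v", symmetric]
    by (intro sum.cong) (auto simp: u_def inv)
  also have "\<dots> = 0" using assms(2) by (simp add: scaleR_left_diff_distrib sum_subtractf)
  finally have "u (bs ! j) = 0"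
    using assms by (intro real_vector.independentD[of "set bs" "set bs"]) (auto simp: ordered_basis_def)
  then show ?thesis using inv assms(3) by (simp add: u_def)
qed

lemma representation_nth:
  assumes "ordered_basis V bs" "i < length bs" "j < length bs"
  shows "representation (set bs) (bs ! i) (bs ! j) = (if i = j then 1 else 0)"
  using assms real_vector.representation_basis[of "set bs" "bs ! i"]
  by (auto simp: ordered_basis_def nth_eq_iff_index_eq)

lemma change_of_basis_carrier [simp]: "change_of_basis bs cs \<in> carrier_mat (length bs) (length bs)"
  by (simp add: change_of_basis_def)

lemma change_of_basis_expansion:
  assumes "ordered_basis V bs" "set cs \<subseteq> V" "length cs = length bs"
  shows "cs = map (\<lambda>i. \<Sum>j<length bs. change_of_basis bs cs $$ (i, j) *\<^sub>R bs ! j) [0..<length bs]"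
proof (rule nth_equalityI)
  fix i assume i: "i < length cs"
  then have "cs ! i \<in> V" using assms(2) by auto
  from ordered_basis_expansion[OF assms(1) this]
  show "cs ! i = map (\<lambda>i. \<Sum>j<length bs. change_of_basis bs cs $$ (i, j) *\<^sub>R bs ! j) [0..<length bs] ! i"
    using i assms(3) by (simp add: change_of_basis_def)
qed (use assms in simp)

lemma change_of_basis_eqI:
  assumes "ordered_basis V bs" "length cs = length bs" "A \<in> carrier_mat (length bs) (length bs)"
    and "cs = map (\<lambda>i. \<Sum>j<length bs. A $$ (i, j) *\<^sub>R bs ! j) [0..<length bs]"
  shows "change_of_basis bs cs = A"
proof (rule eq_matI)
  fix i j assume "i < dim_row A" "j < dim_col A"
  then have ij: "i < length bs" "j < length bs" using assms(3) by auto
  have "set cs \<subseteq> V"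
    using ordered_basis_subset[OF assms(1)] ordered_basis_subspace[OF assms(1)]
    by (subst assms(4)) (auto intro!: subspace_sum subspace_scale)
  then have "cs ! i = (\<Sum>j<length bs. change_of_basis bs cs $$ (i, j) *\<^sub>R bs ! j)"
    using change_of_basis_expansion[OF assms(1) _ assms(2)] ij
    by (metis (no_types, lifting) add_0 diff_zero length_upt nth_map nth_upt)
  moreover have "cs ! i = (\<Sum>j<length bs. A $$ (i, j) *\<^sub>R bs ! j)"
    using ij by (subst assms(4)) simp
  ultimately show "change_of_basis bs cs $$ (i, j) = A $$ (i, j)"
    using ordered_basis_coeffs_unique[OF assms(1), where a="\<lambda>j. change_of_basis bs cs $$ (i, j)"
        and c="\<lambda>j. A $$ (i, j)" and j=j] ij by simp
qed (use assms(3) in \<open>auto simp: change_of_basis_def\<close>)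

text \<open>Row \<open>i\<close> of such a matrix holds the coordinates of the new vector
  \<open>i\<close>, so the later change of basis is the left factor.\<close>

lemma change_of_basis_mult:
  assumes bs: "ordered_basis V bs" and cs: "ordered_basis V cs" and ds: "set ds \<subseteq> V" "length ds = length bs"
  shows "change_of_basis bs ds = change_of_basis cs ds * change_of_basis bs cs"
proof (rule change_of_basis_eqI[OF bs ds(2)])
  let ?m = "length bs"
  let ?B = "change_of_basis bs cs" and ?C = "change_of_basis cs ds"
  have len: "length cs = ?m" using bs cs ordered_basis_length by metis
  have C: "?C \<in> carrier_mat ?m ?m" and B: "?B \<in> carrier_mat ?m ?m"
    using change_of_basis_carrier[of cs ds] len by auto
  then show "?C * ?B \<in> carrier_mat ?m ?m" by simp
  have csi: "cs ! l = (\<Sum>j<?m. ?B $$ (l, j) *\<^sub>R bs ! j)" if "l < ?m" for l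
    using change_of_basis_expansion[OF bs ordered_basis_subset[OF cs] len] that
    by (metis (no_types, lifting) add_0 diff_zero length_upt nth_map nth_upt)
  have dsi: "ds ! i = (\<Sum>l<?m. ?C $$ (i, l) *\<^sub>R cs ! l)" if "i < ?m" for i
    using change_of_basis_expansion[OF cs ds(1)] ds(2) len that
    by (metis (no_types, lifting) add_0 diff_zero length_upt nth_map nth_upt)
  show "ds = map (\<lambda>i. \<Sum>j<?m. (?C * ?B) $$ (i, j) *\<^sub>R bs ! j) [0..<?m]"
  proof (rule nth_equalityI)
    fix i assume "i < length ds"
    then have i: "i < ?m" using ds by simp
    have "ds ! i = (\<Sum>l<?m. ?C $$ (i, l) *\<^sub>R (\<Sum>j<?m. ?B $$ (l, j) *\<^sub>R bs ! j))"
      by (subst dsi[OF i]) (auto intro!: sum.cong simp: csi)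
    also have "\<dots> = (\<Sum>j<?m. (\<Sum>l<?m. ?C $$ (i, l) * ?B $$ (l, j)) *\<^sub>R bs ! j)"
      by (simp only: scaleR_sum_right scaleR_sum_left scaleR_scaleR) (rule sum.swap)
    also have "\<dots> = (\<Sum>j<?m. (?C * ?B) $$ (i, j) *\<^sub>R bs ! j)"
      using i by (intro sum.cong[OF refl] arg_cong2[of _ _ _ _ scaleR] refl)
        (simp add: index_mult_mat(1)[of i "?C" _ "?B"] carrier_matD[OF B] carrier_matD[OF C] scalar_prod_def atLeast0LessThan)
    finally show "ds ! i = map (\<lambda>i. \<Sum>j<?m. (?C * ?B) $$ (i, j) *\<^sub>R bs ! j) [0..<?m] ! i"
      using i by simp
  qed (use ds in simp)
qed

lemma change_of_basis_refl: "ordered_basis V bs \<Longrightarrow> change_of_basis bs bs = 1\<^sub>m (length bs)"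
  by (rule eq_matI) (auto simp: change_of_basis_def representation_nth)

lemma det_change_of_basis_nonzero:
  assumes "ordered_basis V bs" "ordered_basis V cs"
  shows "Determinant.det (change_of_basis bs cs) \<noteq> 0"
proof -
  have len: "length cs = length bs" using assms ordered_basis_length by metis
  have "change_of_basis cs bs * change_of_basis bs cs = 1\<^sub>m (length bs)"
    using change_of_basis_mult[OF assms ordered_basis_subset[OF assms(1)]] change_of_basis_refl[OF assms(1)]
    by simp
  then have "Determinant.det (change_of_basis cs bs) * Determinant.det (change_of_basis bs cs) = 1"
    using det_mult[of "change_of_basis cs bs" "length bs" "change_of_basis bs cs"] len
      change_of_basis_carrier[of cs bs]
    by simp
  then show ?thesis by auto
qed

lemma alternating_form_change_of_basis:
  assumes "subspace T" "alternating_form T m \<alpha>" "ordered_basis V bs" "V \<subseteq> T" "length bs = m"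
    and "set cs \<subseteq> V" "length cs = m"
  shows "\<alpha> cs = Determinant.det (change_of_basis bs cs) * \<alpha> bs"
proof -
  have "\<alpha> cs = \<alpha> (map (\<lambda>i. \<Sum>j<m. change_of_basis bs cs $$ (i, j) *\<^sub>R bs ! j) [0..<m])"
    using change_of_basis_expansion[OF assms(3,6)] assms(5,7) by simp
  also have "\<dots> = Determinant.det (change_of_basis bs cs) * \<alpha> bs"
    using assms ordered_basis_subset[OF assms(3)] change_of_basis_carrier[of bs cs]
    by (intro alternating_form_linear_combination[OF assms(1,2)]) auto
  finally show ?thesis .
qed

lemma orientation_of_eq:
  "ordered_basis V bs \<Longrightarrow>
    orientation_of bs = {cs. ordered_basis V cs \<and> Determinant.det (change_of_basis bs cs) > 0}"
  by (simp add: orientation_of_def ordered_basis_def)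

text \<open>The determinant that defines the orientation class is the ratio of two values of
  \<open>\<alpha>\<close>. Orientations can thus be compared through the sign of one number per
  basis, without multiplying matrices.\<close>

lemma orientation_of_form:
  assumes "subspace T" "alternating_form T m \<alpha>" "ordered_basis V bs" "V \<subseteq> T" "length bs = m" "\<alpha> bs > 0"
  shows "orientation_of bs = {cs. ordered_basis V cs \<and> \<alpha> cs > 0}"
proof -
  have "\<alpha> cs > 0 \<longleftrightarrow> Determinant.det (change_of_basis bs cs) > 0" if "ordered_basis V cs" for cs
    using alternating_form_change_of_basis[OF assms(1-5) ordered_basis_subset[OF that]] assms(3,5,6)
      ordered_basis_length[OF that] ordered_basis_length[OF assms(3)]
    by (simp add: zero_less_mult_iff)
  then show ?thesis by (auto simp: orientation_of_eq[OF assms(3)])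
qed

subsection \<open>Powers of a two-form\<close>

text \<open>For skew-symmetric \<open>M\<close> this is \<open>2 ^ k * fact k\<close> times the
  Pfaffian of \<open>M\<close>.\<close>

definition pairing_sum :: "nat \<Rightarrow> (nat \<Rightarrow> nat \<Rightarrow> real) \<Rightarrow> real" where
  "pairing_sum k M = (\<Sum>\<sigma> | \<sigma> permutes {..<2 * k}.
     of_int (sign \<sigma>) * (\<Prod>i<k. M (\<sigma> (2 * i)) (\<sigma> (2 * i + 1))))"

abbreviation shift_permutation :: "nat \<Rightarrow> (nat \<Rightarrow> nat) \<Rightarrow> nat \<Rightarrow> nat" where
  "shift_permutation m \<equiv> map_permutation {..<m} (\<lambda>j. j + 2)"

lemma bij_shift: "bij_betw (\<lambda>j. j + 2) {..<m} {2..<m + 2::nat}"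
  by (rule bij_betwI[where g = "\<lambda>j. j - 2"]) auto

lemma shift_permutation_permutes:
  "\<tau> permutes {..<m} \<Longrightarrow> shift_permutation m \<tau> permutes {2..<m + 2}"
  using map_permutation_permutes[OF bij_shift] by blast

lemma shift_permutation_apply: "j < m \<Longrightarrow> shift_permutation m \<tau> (j + 2) = \<tau> j + 2"
  using map_permutation_apply[of "\<lambda>j. j + 2" "{..<m}" j] by (auto simp: inj_on_def)

lemma sign_shift_permutation: "\<tau> permutes {..<m} \<Longrightarrow> sign (shift_permutation m \<tau>) = sign \<tau>"
  by (rule sign_map_permutation) (auto simp: inj_on_def)

lemma sum_permutations_shift:
  "(\<Sum>\<sigma> | \<sigma> permutes {2..<m + 2::nat}. f \<sigma>) = (\<Sum>\<tau> | \<tau> permutes {..<m}. f (shift_permutation m \<tau>))"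
proof (rule sum.reindex_bij_witness[where i = "shift_permutation m" and
      j = "map_permutation {2..<m + 2} (\<lambda>j. j - 2)"])
  have bij': "bij_betw (\<lambda>j. j - 2) {2..<m + 2::nat} {..<m}"
    by (rule bij_betwI[where g = "\<lambda>j. j + 2"]) auto
  fix \<sigma> assume "\<sigma> \<in> {\<sigma>. \<sigma> permutes {2..<m + 2}}"
  then show "shift_permutation m (map_permutation {2..<m + 2} (\<lambda>j. j - 2) \<sigma>) = \<sigma>"
    "map_permutation {2..<m + 2} (\<lambda>j. j - 2) \<sigma> \<in> {\<tau>. \<tau> permutes {..<m}}"
    using map_permutation_compose_inv[OF bij', of \<sigma> "\<lambda>j. j + 2"] map_permutation_permutes[OF bij', of \<sigma>]
    by (auto simp del: add_2_eq_Suc')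
  then show "f (shift_permutation m (map_permutation {2..<m + 2} (\<lambda>j. j - 2) \<sigma>)) = f \<sigma>" by simp
next
  fix \<tau> assume "\<tau> \<in> {\<tau>. \<tau> permutes {..<m}}"
  then show "map_permutation {2..<m + 2} (\<lambda>j. j - 2) (shift_permutation m \<tau>) = \<tau>"
    "shift_permutation m \<tau> \<in> {\<sigma>. \<sigma> permutes {2..<m + 2}}"
    using map_permutation_compose_inv[OF bij_shift] shift_permutation_permutes by auto
qed

lemma sign_permutes_compose:
  assumes "finite S" "\<sigma> permutes S" "\<tau> permutes S"
  shows "sign (\<sigma> \<circ> \<tau>) = sign \<sigma> * sign \<tau>"
  using assms by (intro sign_compose permutes_imp_permutation)

text \<open>By induction the power of degree \<open>k\<close> is a sum over permutations
  \<open>\<tau>\<close> of the last \<open>2 * k\<close> positions, nested in a sum over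
  permutations \<open>\<sigma>\<close> of all positions. For fixed \<open>\<tau>\<close>, shifted
  past the first two positions, the substitution of \<open>\<sigma> \<circ> \<tau>\<close> for
  \<open>\<sigma>\<close> turns the outer sum into the whole \<open>pairing_sum\<close>. The
  \<open>fact (2 * k)\<close> equal contributions cancel one normalising factor of
  \<open>wedge\<close>; the other, \<open>fact 2\<close>, accounts for the powers of 2.\<close>

lemma wedge_power_two_form:
  "wedge_power 2 \<omega> k vs = pairing_sum k (\<lambda>i j. \<omega> [vs ! i, vs ! j]) / 2 ^ k"
proof (induction k arbitrary: vs)
  case 0
  then show ?case by (simp add: pairing_sum_def)
next
  case (Suc k)
  let ?S = "{..<2 + 2 * k}"
  let ?M = "\<lambda>i j. \<omega> [vs ! i, vs ! j]"
  let ?T = "{\<tau>. \<tau> permutes {..<2 * k}}"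
  have S: "{..<2 * Suc k} = ?S" by simp
  have pairs: "[0..<2] = [0, Suc 0]" by (simp add: upt_rec)
  have ws: "map (\<lambda>i. vs ! \<sigma> i) [2..<2 + 2 * k] ! j = vs ! \<sigma> (j + 2)" if "j < 2 * k" for \<sigma> j
    using that by (simp add: add.commute del: upt_Suc)
  have inner: "wedge_power 2 \<omega> k (map (\<lambda>i. vs ! \<sigma> i) [2..<2 + 2 * k]) =
     (\<Sum>\<tau>\<in>?T. of_int (sign \<tau>) * (\<Prod>i<k. ?M (\<sigma> (\<tau> (2 * i) + 2)) (\<sigma> (\<tau> (2 * i + 1) + 2)))) / 2 ^ k" for \<sigma>
    unfolding Suc.IH pairing_sum_def
  proof (intro arg_cong2[of _ _ _ _ "(/)"] sum.cong arg_cong2[of _ _ _ _ "(*)"] prod.cong refl)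
    fix \<tau> i assume "\<tau> \<in> ?T" "i \<in> {..<k}"
    then have "\<tau> (2 * i) < 2 * k" "\<tau> (2 * i + 1) < 2 * k"
      using permutes_in_image[of \<tau> "{..<2 * k}"] by auto
    then show "\<omega> [map (\<lambda>i. vs ! \<sigma> i) [2..<2 + 2 * k] ! \<tau> (2 * i),
        map (\<lambda>i. vs ! \<sigma> i) [2..<2 + 2 * k] ! \<tau> (2 * i + 1)] =
      ?M (\<sigma> (\<tau> (2 * i) + 2)) (\<sigma> (\<tau> (2 * i + 1) + 2))"
      by (simp only: ws)
  qed
  have reindex: "(\<Sum>\<sigma> | \<sigma> permutes ?S. of_int (sign \<sigma>) * ?M (\<sigma> 0) (\<sigma> 1) *
       (of_int (sign \<tau>) * (\<Prod>i<k. ?M (\<sigma> (\<tau> (2 * i) + 2)) (\<sigma> (\<tau> (2 * i + 1) + 2))))) =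
     pairing_sum (Suc k) ?M" if \<tau>: "\<tau> \<in> ?T" for \<tau>
  proof -
    let ?\<tau> = "shift_permutation (2 * k) \<tau>"
    have perm2: "?\<tau> permutes {2..<2 * k + 2}" using \<tau> shift_permutation_permutes by blast
    then have perm: "?\<tau> permutes ?S" by (rule permutes_subset) auto
    have fix01: "?\<tau> 0 = 0" "?\<tau> 1 = 1"
      using perm2 by (auto simp: permutes_def)
    have ap: "?\<tau> (j + 2) = \<tau> j + 2" if "j < 2 * k" for j
      using shift_permutation_apply[OF that] .
    have "pairing_sum (Suc k) ?M = (\<Sum>\<sigma> | \<sigma> permutes ?S. of_int (sign (\<sigma> \<circ> ?\<tau>)) *
        (\<Prod>i<Suc k. ?M ((\<sigma> \<circ> ?\<tau>) (2 * i)) ((\<sigma> \<circ> ?\<tau>) (2 * i + 1))))"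
      unfolding pairing_sum_def S by (rule sum_permutations_compose_right[OF perm])
    also have "\<dots> = (\<Sum>\<sigma> | \<sigma> permutes ?S. of_int (sign \<sigma>) * ?M (\<sigma> 0) (\<sigma> 1) *
       (of_int (sign \<tau>) * (\<Prod>i<k. ?M (\<sigma> (\<tau> (2 * i) + 2)) (\<sigma> (\<tau> (2 * i + 1) + 2)))))"
    proof (rule sum.cong[OF refl])
      fix \<sigma> assume "\<sigma> \<in> {\<sigma>. \<sigma> permutes ?S}"
      then have "sign (\<sigma> \<circ> ?\<tau>) = sign \<sigma> * sign \<tau>"
        using perm \<tau> sign_permutes_compose[of ?S] sign_shift_permutation by simp
      moreover have "(\<Prod>i<Suc k. ?M ((\<sigma> \<circ> ?\<tau>) (2 * i)) ((\<sigma> \<circ> ?\<tau>) (2 * i + 1))) =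
         ?M (\<sigma> 0) (\<sigma> 1) * (\<Prod>i<k. ?M (\<sigma> (?\<tau> (2 * i + 2))) (\<sigma> (?\<tau> (2 * i + 1 + 2))))"
        using fix01 by (subst prod.lessThan_Suc_shift) simp
      moreover have "(\<Prod>i<k. ?M (\<sigma> (?\<tau> (2 * i + 2))) (\<sigma> (?\<tau> (2 * i + 1 + 2)))) =
         (\<Prod>i<k. ?M (\<sigma> (\<tau> (2 * i) + 2)) (\<sigma> (\<tau> (2 * i + 1) + 2)))"
      proof (rule prod.cong[OF refl])
        fix i assume "i \<in> {..<k}"
        then have "2 * i < 2 * k" "2 * i + 1 < 2 * k" by auto
        then show "?M (\<sigma> (?\<tau> (2 * i + 2))) (\<sigma> (?\<tau> (2 * i + 1 + 2))) =
            ?M (\<sigma> (\<tau> (2 * i) + 2)) (\<sigma> (\<tau> (2 * i + 1) + 2))"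
          by (simp only: ap)
      qed
      ultimately show "of_int (sign (\<sigma> \<circ> ?\<tau>)) *
        (\<Prod>i<Suc k. ?M ((\<sigma> \<circ> ?\<tau>) (2 * i)) ((\<sigma> \<circ> ?\<tau>) (2 * i + 1))) =
        of_int (sign \<sigma>) * ?M (\<sigma> 0) (\<sigma> 1) *
       (of_int (sign \<tau>) * (\<Prod>i<k. ?M (\<sigma> (\<tau> (2 * i) + 2)) (\<sigma> (\<tau> (2 * i + 1) + 2))))"
        by (simp only: of_int_mult mult.assoc mult.commute mult.left_commute)
    qed
    finally show ?thesis ..
  qed
  have "wedge_power 2 \<omega> (Suc k) vs = (\<Sum>\<sigma> | \<sigma> permutes ?S. \<Sum>\<tau>\<in>?T. of_int (sign \<sigma>) * ?M (\<sigma> 0) (\<sigma> 1) *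
       (of_int (sign \<tau>) * (\<Prod>i<k. ?M (\<sigma> (\<tau> (2 * i) + 2)) (\<sigma> (\<tau> (2 * i + 1) + 2))))) / 2 ^ k / (2 * fact (2 * k))"
    unfolding wedge_power.simps wedge_def inner pairs
    by (simp add: sum_distrib_left sum_divide_distrib del: upt_Suc)
  also have "\<dots> = (\<Sum>\<tau>\<in>?T. pairing_sum (Suc k) ?M) / 2 ^ k / (2 * fact (2 * k))"
    by (subst sum.swap) (simp only: reindex cong: sum.cong)
  also have "\<dots> = pairing_sum (Suc k) ?M / 2 ^ Suc k"
    by (simp add: card_permutations[of "{..<2 * k}" "2 * k"])
  finally show ?case .
qed

text \<open>Exchanging the values \<open>i\<close> and \<open>j\<close> of every permutation
  reverses the signs but leaves each product alone, so the sum equals its own negative.\<close>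

lemma pairing_sum_eq_0:
  assumes "i < 2 * k" "j < 2 * k" "i \<noteq> j" "vs ! i = vs ! j"
  shows "pairing_sum k (\<lambda>i j. \<omega> [vs ! i, vs ! j]) = 0"
proof -
  let ?t = "Transposition.transpose i j"
  let ?S = "{\<sigma>. \<sigma> permutes {..<2 * k}}"
  let ?f = "\<lambda>\<sigma>. of_int (sign \<sigma>) * (\<Prod>q<k. \<omega> [vs ! \<sigma> (2 * q), vs ! \<sigma> (2 * q + 1)])"
  have t: "?t permutes {..<2 * k}" using assms by (intro permutes_swap_id) auto
  have vt: "vs ! ?t a = vs ! a" for a using assms(4) by (simp add: Transposition.transpose_def)
  have "(\<Sum>\<sigma>\<in>?S. ?f \<sigma>) = (\<Sum>\<sigma>\<in>?S. ?f (?t \<circ> \<sigma>))"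
    by (rule setum_permutations_compose_left[OF t])
  also have "\<dots> = (\<Sum>\<sigma>\<in>?S. - ?f \<sigma>)"
    using assms(3) t
    by (intro sum.cong) (simp_all add: vt sign_permutes_compose[of "{..<2 * k}"] sign_swap_id)
  finally show ?thesis by (simp add: pairing_sum_def sum_negf)
qed

text \<open>Each product meets slot \<open>i\<close> exactly once, in the pair that contains its
  preimage \<open>s\<close> under the permutation. Hence exactly one factor varies, and the parity
  of \<open>s\<close> decides which argument of \<open>\<omega>\<close> it is.\<close>

lemma pairing_sum_linear:
  assumes i: "i < 2 * k" "length vs = 2 * k" and vs: "set vs \<subseteq> T" "x \<in> T" "y \<in> T"
    and lin: "\<And>v. v \<in> T \<Longrightarrow> \<omega> [a *\<^sub>R x + b *\<^sub>R y, v] = a * \<omega> [x, v] + b * \<omega> [y, v]"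
      "\<And>v. v \<in> T \<Longrightarrow> \<omega> [v, a *\<^sub>R x + b *\<^sub>R y] = a * \<omega> [v, x] + b * \<omega> [v, y]"
  shows "pairing_sum k (\<lambda>p q. \<omega> [vs[i := a *\<^sub>R x + b *\<^sub>R y] ! p, vs[i := a *\<^sub>R x + b *\<^sub>R y] ! q]) =
     a * pairing_sum k (\<lambda>p q. \<omega> [vs[i := x] ! p, vs[i := x] ! q]) +
     b * pairing_sum k (\<lambda>p q. \<omega> [vs[i := y] ! p, vs[i := y] ! q])"
proof -
  let ?P = "\<lambda>u \<sigma> q. \<omega> [vs[i := u] ! \<sigma> (2 * q), vs[i := u] ! \<sigma> (2 * q + 1)]"
  have "(\<Prod>q<k. ?P (a *\<^sub>R x + b *\<^sub>R y) \<sigma> q) = a * (\<Prod>q<k. ?P x \<sigma> q) + b * (\<Prod>q<k. ?P y \<sigma> q)"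
    if \<sigma>: "\<sigma> permutes {..<2 * k}" for \<sigma>
  proof -
    have lt: "\<sigma> j < 2 * k" if "j < 2 * k" for j
      using permutes_in_image[OF \<sigma>, of j] that by auto
    have "i \<in> \<sigma> ` {..<2 * k}" using permutes_image[OF \<sigma>] i by simp
    then obtain s where s: "s < 2 * k" "\<sigma> s = i" by auto
    have eq: "\<sigma> j = i \<longleftrightarrow> j = s" for j
      using s permutes_inj[OF \<sigma>] by (metis injD)
    define q where "q = s div 2"
    have q: "q < k" using s(1) by (auto simp: q_def)
    have vT: "vs ! j \<in> T" if "j < 2 * k" for j using that vs i by auto
    have split: "(\<Prod>q<k. ?P u \<sigma> q) = ?P u \<sigma> q * (\<Prod>r\<in>{..<k} - {q}. ?P u \<sigma> r)" for u
      using q by (intro prod.remove) auto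
    have rest: "(\<Prod>r\<in>{..<k} - {q}. ?P u \<sigma> r) =
        (\<Prod>r\<in>{..<k} - {q}. \<omega> [vs ! \<sigma> (2 * r), vs ! \<sigma> (2 * r + 1)])" for u
    proof (rule prod.cong[OF refl])
      fix r assume "r \<in> {..<k} - {q}"
      then have "2 * r \<noteq> s" "2 * r + 1 \<noteq> s" by (auto simp: q_def)
      then show "?P u \<sigma> r = \<omega> [vs ! \<sigma> (2 * r), vs ! \<sigma> (2 * r + 1)]" by (simp add: eq[symmetric])
    qed
    have "?P (a *\<^sub>R x + b *\<^sub>R y) \<sigma> q = a * ?P x \<sigma> q + b * ?P y \<sigma> q"
    proof (cases "even s")
      case True
      then have "s = 2 * q" by (simp add: q_def)
      moreover have "\<sigma> (2 * q + 1) < 2 * k" "\<sigma> (2 * q + 1) \<noteq> i"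
        using \<open>s = 2 * q\<close> q by (auto simp only: eq intro!: lt)
      ultimately show ?thesis using s i lin(1)[OF vT] by simp
    next
      case False
      then have "s = 2 * q + 1" by (simp add: q_def)
      moreover have "\<sigma> (2 * q) < 2 * k" "\<sigma> (2 * q) \<noteq> i"
        using \<open>s = 2 * q + 1\<close> q by (auto simp only: eq intro!: lt)
      ultimately show ?thesis using s i lin(2)[OF vT] by simp
    qed
    then show ?thesis unfolding split rest by (simp add: algebra_simps)
  qed
  then show ?thesis
    unfolding pairing_sum_def
    by (simp add: sum_distrib_left flip: sum.distrib) (intro sum.cong, auto simp: algebra_simps)
qed

definition divided_power :: "('v list \<Rightarrow> real) \<Rightarrow> nat \<Rightarrow> 'v list \<Rightarrow> real" where
  "divided_power \<omega> k vs = wedge_power 2 \<omega> k vs / fact k"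

lemma divided_power_eq: "divided_power \<omega> k vs = pairing_sum k (\<lambda>i j. \<omega> [vs ! i, vs ! j]) / (2 ^ k * fact k)"
  by (simp add: divided_power_def wedge_power_two_form)

lemma divided_power_0 [simp]: "divided_power \<omega> 0 vs = 1"
  by (simp add: divided_power_def)

text \<open>Alternation comes from the signs in the permutation sum, multilinearity from the
  individual products.\<close>

lemma alternating_form_divided_power:
  assumes "\<And>a b x y v. x \<in> T \<Longrightarrow> y \<in> T \<Longrightarrow> v \<in> T \<Longrightarrow> \<omega> [a *\<^sub>R x + b *\<^sub>R y, v] = a * \<omega> [x, v] + b * \<omega> [y, v]"
    and "\<And>a b x y v. x \<in> T \<Longrightarrow> y \<in> T \<Longrightarrow> v \<in> T \<Longrightarrow> \<omega> [v, a *\<^sub>R x + b *\<^sub>R y] = a * \<omega> [v, x] + b * \<omega> [v, y]"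
  shows "alternating_form T (2 * k) (divided_power \<omega> k)"
  unfolding alternating_form_def divided_power_eq
proof (intro allI impI conjI ballI)
  fix vs i x y a b assume "length vs = 2 * k \<and> set vs \<subseteq> T" "i < 2 * k" "x \<in> T" "y \<in> T"
  then show "pairing_sum k (\<lambda>p q. \<omega> [vs[i := a *\<^sub>R x + b *\<^sub>R y] ! p, vs[i := a *\<^sub>R x + b *\<^sub>R y] ! q]) / (2 ^ k * fact k) =
     a * (pairing_sum k (\<lambda>p q. \<omega> [vs[i := x] ! p, vs[i := x] ! q]) / (2 ^ k * fact k)) +
     b * (pairing_sum k (\<lambda>p q. \<omega> [vs[i := y] ! p, vs[i := y] ! q]) / (2 ^ k * fact k))"
    by (subst pairing_sum_linear[where T = T]) (simp_all add: assms add_divide_distrib)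
next
  fix vs :: "'a list" and i j assume "i < 2 * k" "j < 2 * k" "i \<noteq> j \<and> vs ! i = vs ! j"
  then have "pairing_sum k (\<lambda>i j. \<omega> [vs ! i, vs ! j]) = 0"
    using pairing_sum_eq_0[of i k j vs \<omega>] by simp
  then show "pairing_sum k (\<lambda>i j. \<omega> [vs ! i, vs ! j]) / (2 ^ k * fact k) = 0" by simp
qed

section \<open>Expansion of the pairing sum along a row\<close>

lemma sum_even_odd: "(\<Sum>q<n::nat. f (2 * q) + f (2 * q + 1)) = (\<Sum>j<2 * n. f j :: 'a :: comm_monoid_add)"
  by (induction n) (auto simp: add.assoc)

text \<open>Pfaffian expansion along row 0 when only the entry \<open>M 0 1\<close> survives. Each
  permutation takes the value 0 at exactly one of the \<open>2 * (k + 1)\<close> positions, and by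
  symmetry each position contributes the same amount \<open>Z\<close>; this is the origin of the
  factor.\<close>

lemma pairing_sum_expand:
  assumes skew: "\<And>j. j < 2 * k + 2 \<Longrightarrow> M j 0 = - M 0 j" and zero: "\<And>j. 2 \<le> j \<Longrightarrow> j < 2 * k + 2 \<Longrightarrow> M 0 j = 0"
  shows "pairing_sum (Suc k) M = 2 * (k + 1) * M 0 1 * pairing_sum k (\<lambda>i j. M (i + 2) (j + 2))"
proof -
  let ?N = "{..<2 * Suc k}"
  let ?S = "{\<sigma>. \<sigma> permutes ?N}"
  let ?R = "\<lambda>\<sigma> q. M (\<sigma> (2 * q)) (\<sigma> (2 * q + 1))"
  define t where "t \<sigma> = of_int (sign \<sigma>) * (\<Prod>q<Suc k. ?R \<sigma> q)" for \<sigma>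
  have fin: "finite ?S" by (simp add: finite_permutations)
  define Z where "Z = (\<Sum>\<sigma>\<in>?S. of_bool (\<sigma> 0 = 0) * t \<sigma>)"
  \<comment> \<open>Exchanging pair 0 with pair \<open>q\<close> takes two transpositions, hence has
    sign 1, and merely permutes the factors of the product. For \<open>q = 0\<close> both
    transpositions are the identity.\<close>
  have even: "(\<Sum>\<sigma>\<in>?S. of_bool (\<sigma> (2 * q) = 0) * t \<sigma>) = Z" if q: "q < Suc k" for q
  proof -
    let ?a = "Transposition.transpose 0 (2 * q)" and ?b = "Transposition.transpose 1 (2 * q + 1)"
    let ?\<rho> = "?a \<circ> ?b"
    have ab: "?a permutes ?N" "?b permutes ?N" using q by (auto intro!: permutes_swap_id)
    have \<rho>: "?\<rho> permutes ?N" using permutes_compose[OF ab(2,1)] .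
    have sg: "sign ?\<rho> = 1" using sign_permutes_compose[OF _ ab] by (simp add: sign_swap_id)
    let ?c = "Transposition.transpose 0 q"
    have rho_pair: "?\<rho> (2 * r) = 2 * ?c r" "?\<rho> (2 * r + 1) = 2 * ?c r + 1" for r
      by (auto simp: Transposition.transpose_def) presburger+
    have "t (\<sigma> \<circ> ?\<rho>) = t \<sigma>" if "\<sigma> \<in> ?S" for \<sigma>
    proof -
      have "sign (\<sigma> \<circ> ?\<rho>) = sign \<sigma>"
        using that \<rho> sg sign_permutes_compose[of ?N \<sigma> ?\<rho>] by simp
      moreover have "(\<Prod>r<Suc k. ?R (\<sigma> \<circ> ?\<rho>) r) = (\<Prod>r<Suc k. ?R \<sigma> (?c r))"
        by (intro prod.cong refl) (metis comp_apply rho_pair)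
      moreover have "\<dots> = (\<Prod>r<Suc k. ?R \<sigma> r)"
        using q by (intro prod.permute[symmetric, unfolded o_def] permutes_swap_id) auto
      ultimately show ?thesis by (simp only: t_def)
    qed
    moreover have "(\<sigma> \<circ> ?\<rho>) (2 * q) = \<sigma> 0" for \<sigma>
      using rho_pair(1)[of q] by simp
    ultimately show ?thesis
      unfolding Z_def by (subst sum_permutations_compose_right[OF \<rho>]) (intro sum.cong, auto)
  qed
  \<comment> \<open>Exchanging the two entries of pair \<open>q\<close> costs a sign, which the
    skewness of row 0 gives back in factor \<open>q\<close>; the other factors do not move.\<close>
  have odd: "(\<Sum>\<sigma>\<in>?S. of_bool (\<sigma> (2 * q + 1) = 0) * t \<sigma>) = Z" if q: "q < Suc k" for q
  proof -
    let ?\<rho> = "Transposition.transpose (2 * q) (2 * q + 1)"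
    have \<rho>: "?\<rho> permutes ?N" using q by (auto intro!: permutes_swap_id)
    have "of_bool ((\<sigma> \<circ> ?\<rho>) (2 * q + 1) = 0) * t (\<sigma> \<circ> ?\<rho>) = of_bool (\<sigma> (2 * q) = 0) * t \<sigma>" if "\<sigma> \<in> ?S" for \<sigma>
    proof (cases "\<sigma> (2 * q) = 0")
      case True
      have "sign (\<sigma> \<circ> ?\<rho>) = - sign \<sigma>"
        using that \<rho> sign_permutes_compose[of ?N \<sigma> ?\<rho>] by (simp add: sign_swap_id)
      moreover have "(\<Prod>r<Suc k. ?R (\<sigma> \<circ> ?\<rho>) r) = ?R (\<sigma> \<circ> ?\<rho>) q * (\<Prod>r\<in>{..<Suc k} - {q}. ?R (\<sigma> \<circ> ?\<rho>) r)"
        using q by (intro prod.remove) auto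
      moreover have "\<sigma> (2 * q + 1) < 2 * k + 2"
        using that q permutes_in_image[of \<sigma> ?N "2 * q + 1"] by simp
      then have "?R (\<sigma> \<circ> ?\<rho>) q = - ?R \<sigma> q" using True skew[of "\<sigma> (2 * q + 1)"] by simp
      moreover have "(\<Prod>r\<in>{..<Suc k} - {q}. ?R (\<sigma> \<circ> ?\<rho>) r) = (\<Prod>r\<in>{..<Suc k} - {q}. ?R \<sigma> r)"
      proof (rule prod.cong[OF refl])
        fix r assume "r \<in> {..<Suc k} - {q}"
        then have "?\<rho> (2 * r) = 2 * r" "?\<rho> (2 * r + 1) = 2 * r + 1"
          by (auto simp: Transposition.transpose_def)
        then show "?R (\<sigma> \<circ> ?\<rho>) r = ?R \<sigma> r" by simp
      qed
      moreover have "(\<Prod>r<Suc k. ?R \<sigma> r) = ?R \<sigma> q * (\<Prod>r\<in>{..<Suc k} - {q}. ?R \<sigma> r)"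
        using q by (intro prod.remove) auto
      ultimately have "t (\<sigma> \<circ> ?\<rho>) = t \<sigma>" by (simp only: t_def)
      then show ?thesis using True by simp
    qed simp
    then show ?thesis
      unfolding even[OF q, symmetric]
      by (subst sum_permutations_compose_right[OF \<rho>]) (intro sum.cong, auto)
  qed
  \<comment> \<open>A partition of unity indexed by the position of the value 0; multiplying each
    term by it splits the sum into contributions of single positions.\<close>
  have count: "(\<Sum>q<Suc k. of_bool (\<sigma> (2 * q) = 0) + of_bool (\<sigma> (2 * q + 1) = 0)) = (1::real)" if "\<sigma> \<in> ?S" for \<sigma>
  proof -
    have "(\<Sum>q<Suc k. of_bool (\<sigma> (2 * q) = 0) + of_bool (\<sigma> (2 * q + 1) = 0)) =
        (\<Sum>j<2 * Suc k. of_bool (\<sigma> j = 0) :: real)"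
      by (rule sum_even_odd)
    also have "\<dots> = (\<Sum>j<2 * Suc k. of_bool (j = 0))"
      using sum.permute[of \<sigma> "{..<2 * Suc k}" "\<lambda>j. of_bool (j = 0) :: real"] that by (simp only: mem_Collect_eq o_def)
    also have "\<dots> = 1" by (simp only: of_bool_def sum.delta finite_lessThan) simp
    finally show ?thesis .
  qed
  have "pairing_sum (Suc k) M = (\<Sum>\<sigma>\<in>?S. t \<sigma>)"
    by (simp only: pairing_sum_def t_def)
  also have "\<dots> = (\<Sum>\<sigma>\<in>?S. \<Sum>q<Suc k. of_bool (\<sigma> (2 * q) = 0) * t \<sigma> + of_bool (\<sigma> (2 * q + 1) = 0) * t \<sigma>)"
    by (intro sum.cong refl) (simp only: flip: distrib_right sum_distrib_right, simp only: count mult_1)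
  also have "\<dots> = (\<Sum>q<Suc k. Z + Z)"
    by (subst sum.swap) (intro sum.cong refl, simp only: sum.distrib even odd lessThan_iff)
  also have "\<dots> = 2 * (k + 1) * Z" by simp
  also have "Z = M 0 1 * pairing_sum k (\<lambda>i j. M (i + 2) (j + 2))"
  proof -
    let ?S2 = "{\<sigma>. \<sigma> permutes {2..<2 * k + 2}}"
    have "{2..<2 * k + 2} \<subseteq> ?N" by auto
    then have sub: "?S2 \<subseteq> ?S" using permutes_subset by blast
    have "Z = (\<Sum>\<sigma>\<in>?S2. of_bool (\<sigma> 0 = 0) * t \<sigma>)"
      unfolding Z_def
    proof (rule sum.mono_neutral_right[OF fin sub], rule ballI)
      fix \<sigma> assume \<sigma>: "\<sigma> \<in> ?S - ?S2"
      show "of_bool (\<sigma> 0 = 0) * t \<sigma> = 0"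
      proof (cases "\<sigma> 0 = 0")
        \<comment> \<open>Here \<open>\<sigma> 1\<close> must be at least 2: the value 0 is taken
          already, and with the value 1 the permutation would fix both first indices and belong to
          \<open>?S2\<close>. So the first factor is a vanishing entry of row 0.\<close>
        case True
        have "\<sigma> 1 \<noteq> 1"
        proof
          assume "\<sigma> 1 = 1"
          have "\<sigma> x = x" if "x \<in> ?N - {2..<2 * k + 2}" for x
          proof -
            have "x = 0 \<or> x = 1" using that by auto
            then show ?thesis using True \<open>\<sigma> 1 = 1\<close> by auto
          qed
          moreover have "\<sigma> permutes ?N" using \<sigma> by blast
          ultimately have "\<sigma> permutes {2..<2 * k + 2}" by (blast intro: permutes_superset[of \<sigma> ?N])
          then show False using \<sigma> by blast
        qed
        moreover have "\<sigma> 1 \<noteq> 0" 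
        proof
          assume "\<sigma> 1 = 0"
          then have "\<sigma> 1 = \<sigma> 0" using True by simp
          moreover have "inj \<sigma>" using \<sigma> permutes_inj[of \<sigma> ?N] by blast
          ultimately have "1 = (0::nat)" by (rule injD[rotated])
          then show False by simp
        qed
        moreover have "\<sigma> 1 < 2 * k + 2" 
        proof -
          have "\<sigma> permutes ?N" using \<sigma> by blast
          then show ?thesis using permutes_in_image[of \<sigma> ?N 1] by simp
        qed
        ultimately have "?R \<sigma> 0 = 0" using True zero[of "\<sigma> 1"] by simp
        then have "(\<Prod>q<Suc k. ?R \<sigma> q) = 0" by (subst prod.remove[of _ 0]) auto
        then show ?thesis by (simp only: t_def)
      qed simp
    qed
    also have "\<dots> = (\<Sum>\<sigma>\<in>?S2. t \<sigma>)"
      by (intro sum.cong refl) (simp add: permutes_not_in[of _ "{2..<2 * k + 2}" 0])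
    also have "\<dots> = (\<Sum>\<tau> | \<tau> permutes {..<2 * k}. t (shift_permutation (2 * k) \<tau>))"
      by (rule sum_permutations_shift)
    also have "\<dots> = (\<Sum>\<tau> | \<tau> permutes {..<2 * k}. M 0 1 * (of_int (sign \<tau>) *
        (\<Prod>i<k. M (\<tau> (2 * i) + 2) (\<tau> (2 * i + 1) + 2))))"
    proof (rule sum.cong[OF refl])
      fix \<tau> assume \<tau>: "\<tau> \<in> {\<tau>. \<tau> permutes {..<2 * k}}"
      let ?\<tau> = "shift_permutation (2 * k) \<tau>"
      have fix01: "?\<tau> 0 = 0" "?\<tau> 1 = 1"
        using shift_permutation_permutes[of \<tau> "2 * k"] \<tau> by (auto simp: permutes_def)
      have "(\<Prod>q<Suc k. ?R ?\<tau> q) = M 0 1 * (\<Prod>i<k. M (?\<tau> (2 * i + 2)) (?\<tau> (2 * i + 1 + 2)))"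
        using fix01 by (subst prod.lessThan_Suc_shift) simp
      also have "(\<Prod>i<k. M (?\<tau> (2 * i + 2)) (?\<tau> (2 * i + 1 + 2))) =
          (\<Prod>i<k. M (\<tau> (2 * i) + 2) (\<tau> (2 * i + 1) + 2))"
      proof (rule prod.cong[OF refl])
        fix i assume "i \<in> {..<k}"
        then have "2 * i < 2 * k" "2 * i + 1 < 2 * k" by auto
        then show "M (?\<tau> (2 * i + 2)) (?\<tau> (2 * i + 1 + 2)) = M (\<tau> (2 * i) + 2) (\<tau> (2 * i + 1) + 2)"
          by (simp only: shift_permutation_apply)
      qed
      finally show "t ?\<tau> = M 0 1 * (of_int (sign \<tau>) * (\<Prod>i<k. M (\<tau> (2 * i) + 2) (\<tau> (2 * i + 1) + 2)))"
        using \<tau> sign_shift_permutation by (simp add: t_def)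
    qed
    also have "\<dots> = M 0 1 * pairing_sum k (\<lambda>i j. M (i + 2) (j + 2))"
      by (simp only: pairing_sum_def sum_distrib_left)
    finally show ?thesis .
  qed
  finally show ?thesis by (simp add: mult.assoc)
qed

text \<open>The factor \<open>2 * (k + 1)\<close> of the expansion is exactly the quotient of two
  consecutive normalisations \<open>2 ^ k * fact k\<close>, so dividing the power by the factorial
  removes all constants.\<close>

lemma divided_power_expand:
  assumes "\<And>x. x \<in> set (u # w # ws) \<Longrightarrow> \<omega> [x, u] = - \<omega> [u, x]"
    and "\<And>x. x \<in> set ws \<Longrightarrow> \<omega> [u, x] = 0" "length ws = 2 * k"
  shows "divided_power \<omega> (Suc k) (u # w # ws) = \<omega> [u, w] * divided_power \<omega> k ws"
proof -
  have "\<omega> [u, (u # w # ws) ! j] = 0" if "2 \<le> j" "j < 2 * k + 2" for j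
    using that assms(2,3) by (auto simp: nth_Cons numeral_2_eq_2 split: nat.split)
  moreover have "\<omega> [(u # w # ws) ! j, u] = - \<omega> [u, (u # w # ws) ! j]" if "j < 2 * k + 2" for j
    using that assms(3) by (intro assms(1) nth_mem) simp
  ultimately have "pairing_sum (Suc k) (\<lambda>i j. \<omega> [(u # w # ws) ! i, (u # w # ws) ! j]) =
      2 * (k + 1) * \<omega> [u, w] * pairing_sum k (\<lambda>i j. \<omega> [ws ! i, ws ! j])"
    by (subst pairing_sum_expand) auto
  moreover have "2 * (k + 1) * x / (2 ^ Suc k * fact (Suc k)) = x / (2 ^ k * fact k)" for x :: real
  proof -
    have "2 ^ Suc k * fact (Suc k) = 2 * (k + 1) * (2 ^ k * fact k :: real)" by simp
    then show ?thesis by (simp only: mult_divide_mult_cancel_left) simp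
  qed
  ultimately show ?thesis by (simp only: divided_power_eq mult.assoc) simp
qed

subsection \<open>Orthonormal bases\<close>

text \<open>Slots are corrected one after another, and \<open>pre\<close> collects those already
  restored to their entry in \<open>xs\<close>; each correction only drops values with a repeated
  \<open>u\<close> or \<open>w\<close>. This is what lets complex Gram-Schmidt make vectors
  orthogonal to a complex line without changing the value of the form.\<close>

lemma alternating_form_shear:
  assumes T: "subspace T" and alt: "alternating_form T (length pre + length xs + 2) \<alpha>"
    and "list_all2 (\<lambda>x y. \<exists>c d. y = x + c *\<^sub>R u + d *\<^sub>R w) xs ys"
    and "u \<in> T" "w \<in> T" "set pre \<subseteq> T" "set xs \<subseteq> T"
  shows "\<alpha> (u # w # pre @ ys) = \<alpha> (u # w # pre @ xs)"
  using assms(3,2,4-)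
proof (induction xs ys arbitrary: pre rule: list_all2_induct)
  case Nil
  then show ?case by simp
next
  case (Cons x xs y ys)
  let ?m = "length pre + length (x # xs) + 2" and ?i = "length pre + 2"
  let ?vs = "u # w # pre @ x # ys"
  from Cons(1) obtain c d where y: "y = x + c *\<^sub>R u + d *\<^sub>R w" by blast
  have ys: "set ys \<subseteq> T"
  proof
    fix z assume "z \<in> set ys"
    then obtain i where "i < length ys" "ys ! i = z" by (auto simp: in_set_conv_nth)
    then obtain x c d where "x \<in> set xs" "z = x + c *\<^sub>R u + d *\<^sub>R w"
      using Cons(2) nth_mem[of i xs] unfolding list_all2_conv_all_nth by fastforce
    then show "z \<in> T" using Cons.prems T by (auto intro!: subspace_add subspace_scale)
  qed
  have len: "length ys = length xs" using Cons(2) by (simp add: list_all2_lengthD)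
  have upd: "?vs[?i := z] = u # w # pre @ z # ys" for z by (simp add: list_update_append)
  have vs: "length ?vs = ?m" "set ?vs \<subseteq> T" "?i < ?m" using len ys Cons.prems by auto
  have lin: "\<alpha> (?vs[?i := a *\<^sub>R p + b *\<^sub>R q]) = a * \<alpha> (?vs[?i := p]) + b * \<alpha> (?vs[?i := q])"
    if "p \<in> T" "q \<in> T" for a b p q
    using Cons.prems(1) vs that unfolding alternating_form_def by blast
  have zero: "\<alpha> (?vs[?i := u]) = 0" "\<alpha> (?vs[?i := w]) = 0"
  proof -
    have *: "length (?vs[?i := z]) = ?m" "set (?vs[?i := z]) \<subseteq> T" if "z \<in> T" for z
      using vs that by (auto simp: upd)
    have "\<alpha> (?vs[?i := z]) = 0" if "z \<in> T" "j < 2" "?vs[?i := z] ! j = z" for z j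
    proof -
      have "j < ?m" "?i \<noteq> j" "?vs[?i := z] ! ?i = ?vs[?i := z] ! j" using that vs by (auto simp: nth_list_update)
      then show ?thesis using Cons.prems(1) *[OF that(1)] vs(3) unfolding alternating_form_def by blast
    qed
    from this[of u 0] this[of w 1] show "\<alpha> (?vs[?i := u]) = 0" "\<alpha> (?vs[?i := w]) = 0"
      using Cons.prems by auto
  qed
  have "x + c *\<^sub>R u \<in> T" using Cons.prems T by (auto intro!: subspace_add subspace_scale)
  then have "\<alpha> (?vs[?i := y]) = \<alpha> (?vs[?i := x])"
    using lin[of "x + c *\<^sub>R u" w 1 d] lin[of x u 1 c] Cons.prems zero by (simp only: y) (simp del: list_update.simps append.simps)
  then have "\<alpha> (u # w # pre @ y # ys) = \<alpha> (u # w # pre @ x # ys)" by (simp only: upd)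
  also have "\<dots> = \<alpha> (u # w # (pre @ [x]) @ ys)" by simp
  also have "\<dots> = \<alpha> (u # w # (pre @ [x]) @ xs)"
    using Cons.prems by (intro Cons.IH) auto
  finally show ?case by simp
qed

text \<open>Both orders of the arguments occur because \<open>h\<close> is an arbitrary function
  here, with no symmetry.\<close>

lemma orthonormal_append_iff:
  "orthonormal h (us @ ws) \<longleftrightarrow> orthonormal h us \<and> orthonormal h ws \<and>
     (\<forall>x\<in>set us. \<forall>y\<in>set ws. h x y = 0 \<and> h y x = 0)" (is "?L \<longleftrightarrow> ?R")
proof
  assume L: ?L
  have *: "h ((us @ ws) ! i) ((us @ ws) ! j) = (if i = j then 1 else 0)"
    if "i < length us + length ws" "j < length us + length ws" for i j
    using L that by (auto simp: orthonormal_def)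
  have "orthonormal h us" unfolding orthonormal_def
  proof (intro allI impI)
    fix i j assume "i < length us" "j < length us"
    then show "h (us ! i) (us ! j) = (if i = j then 1 else 0)" using *[of i j] by (simp add: nth_append)
  qed
  moreover have "orthonormal h ws" unfolding orthonormal_def
  proof (intro allI impI)
    fix i j assume "i < length ws" "j < length ws"
    then show "h (ws ! i) (ws ! j) = (if i = j then 1 else 0)"
      using *[of "length us + i" "length us + j"] by (simp add: nth_append)
  qed
  moreover have "h x y = 0 \<and> h y x = 0" if "x \<in> set us" "y \<in> set ws" for x y
  proof -
    obtain i j where "i < length us" "us ! i = x" "j < length ws" "ws ! j = y"
      using \<open>x \<in> set us\<close> \<open>y \<in> set ws\<close> by (auto simp: in_set_conv_nth)
    then show ?thesis
      using *[of i "length us + j"] *[of "length us + j" i] by (simp add: nth_append)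
  qed
  ultimately show ?R by blast
next
  assume R: ?R
  show ?L unfolding orthonormal_def
  proof (intro allI impI)
    fix i j assume ij: "i < length (us @ ws)" "j < length (us @ ws)"
    consider "i < length us" "j < length us" | "i < length us" "\<not> j < length us"
      | "\<not> i < length us" "j < length us" | "\<not> i < length us" "\<not> j < length us" by blast
    then show "h ((us @ ws) ! i) ((us @ ws) ! j) = (if i = j then 1 else 0)"
    proof cases
      case 1
      then show ?thesis using R by (auto simp: orthonormal_def nth_append)
    next
      case 2
      then show ?thesis using R ij by (auto simp: nth_append)
    next
      case 3
      then show ?thesis using R ij by (auto simp: nth_append)
    next
      case 4
      then have "i - length us < length ws" "j - length us < length ws" using ij by auto
      then show ?thesis using R 4 unfolding orthonormal_def by (auto simp: nth_append)
    qed
  qed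
qed

lemma orthonormal_single [simp]: "orthonormal h [x] \<longleftrightarrow> h x x = 1"
  by (simp add: orthonormal_def)

lemma orthonormal_Nil [simp]: "orthonormal h []"
  by (simp add: orthonormal_def)

lemma orthonormal_Cons_iff:
  "orthonormal h (x # us) \<longleftrightarrow> h x x = 1 \<and> orthonormal h us \<and> (\<forall>y\<in>set us. h x y = 0 \<and> h y x = 0)"
  using orthonormal_append_iff[of h "[x]" us] by auto

abbreviation complex_flat :: "('v \<Rightarrow> 'v) \<Rightarrow> 'v list \<Rightarrow> 'v list" where
  "complex_flat J es \<equiv> concat (map (\<lambda>e. [J e, e]) es)"

lemma length_complex_flat: "length (complex_flat J es) = 2 * length es"
  by (induction es) auto

lemma complex_flat_nth:
  "i < length es \<Longrightarrow> complex_flat J es ! (2 * i) = J (es ! i)"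
  "i < length es \<Longrightarrow> complex_flat J es ! (2 * i + 1) = es ! i"
proof (induction es arbitrary: i)
  case (Cons e es)
  {
    case 1
    then show ?case using Cons(1)[of "i - 1"] by (cases i) auto
  next
    case 2
    then show ?case using Cons(2)[of "i - 1"] by (cases i) auto
  }
qed auto

lemma set_complex_flat: "set (complex_flat J es) = J ` set es \<union> set es"
  by (induction es) auto

lemma nth_mem_subset: "set xs \<subseteq> V \<Longrightarrow> i < length xs \<Longrightarrow> xs ! i \<in> V"
  using nth_mem by blast

text \<open>The inner product is specified on the subspace \<open>T\<close> only: at a point of the
  manifold the metric says nothing about families of coordinate vectors that are not tangent
  vectors. Finite dimension enters through the ordered bases of the subspaces
  \<open>V\<close>.\<close>

locale euclidean_subspace =
  fixes T :: "'v::real_vector set" and h :: "'v \<Rightarrow> 'v \<Rightarrow> real"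
  assumes subspace_T: "subspace T"
    and h_linear: "\<And>x y z a b. x \<in> T \<Longrightarrow> y \<in> T \<Longrightarrow> z \<in> T \<Longrightarrow> h (a *\<^sub>R x + b *\<^sub>R y) z = a * h x z + b * h y z"
    and h_sym: "\<And>x y. x \<in> T \<Longrightarrow> y \<in> T \<Longrightarrow> h x y = h y x"
    and h_pos: "\<And>x. x \<in> T \<Longrightarrow> x \<noteq> 0 \<Longrightarrow> h x x > 0"
begin

lemma T_closed [simp, intro]:
  "0 \<in> T" "x \<in> T \<Longrightarrow> y \<in> T \<Longrightarrow> x + y \<in> T" "x \<in> T \<Longrightarrow> y \<in> T \<Longrightarrow> x - y \<in> T"
  "x \<in> T \<Longrightarrow> - x \<in> T" "x \<in> T \<Longrightarrow> a *\<^sub>R x \<in> T" "(\<And>i. i \<in> I \<Longrightarrow> f i \<in> T) \<Longrightarrow> sum f I \<in> T"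
  using subspace_T by (auto intro: subspace_0 subspace_add subspace_diff subspace_neg subspace_scale subspace_sum)

lemma h_left_simps [simp]:
  assumes "x \<in> T" "z \<in> T"
  shows "y \<in> T \<Longrightarrow> h (x + y) z = h x z + h y z" "y \<in> T \<Longrightarrow> h (x - y) z = h x z - h y z"
    "h (- x) z = - h x z" "h (a *\<^sub>R x) z = a * h x z"
  using h_linear[OF assms(1) _ assms(2), of y 1 1] h_linear[OF assms(1) _ assms(2), of y 1 "- 1"]
    h_linear[OF assms(1,1,2), of "- 1" 0] h_linear[OF assms(1,1,2), of a 0] by simp_all

lemma h_right_simps [simp]:
  assumes "x \<in> T" "z \<in> T"
  shows "y \<in> T \<Longrightarrow> h z (x + y) = h z x + h z y" "y \<in> T \<Longrightarrow> h z (x - y) = h z x - h z y"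
    "h z (- x) = - h z x" "h z (a *\<^sub>R x) = a * h z x"
  using assms by (simp_all add: h_sym[of z])

lemma h_zero [simp]: "x \<in> T \<Longrightarrow> h 0 x = 0" "x \<in> T \<Longrightarrow> h x 0 = 0"
  using h_left_simps(4)[of 0 x 0] h_right_simps(4)[of 0 x 0] by auto

lemma h_sum_left: "finite I \<Longrightarrow> (\<And>i. i \<in> I \<Longrightarrow> f i \<in> T) \<Longrightarrow> z \<in> T \<Longrightarrow> h (\<Sum>i\<in>I. a i *\<^sub>R f i) z = (\<Sum>i\<in>I. a i * h (f i) z)"
  by (induction I rule: finite_induct) auto

lemma h_sum_right: "finite I \<Longrightarrow> (\<And>i. i \<in> I \<Longrightarrow> f i \<in> T) \<Longrightarrow> z \<in> T \<Longrightarrow> h z (\<Sum>i\<in>I. a i *\<^sub>R f i) = (\<Sum>i\<in>I. a i * h z (f i))"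
  by (induction I rule: finite_induct) auto

lemma h_nonneg: "x \<in> T \<Longrightarrow> h x x \<ge> 0"
  using h_pos[of x] by (cases "x = 0") auto

lemma orthonormal_coeff:
  assumes "orthonormal h us" "set us \<subseteq> T" "i < length us"
  shows "h (\<Sum>j<length us. a j *\<^sub>R us ! j) (us ! i) = a i"
proof -
  have "h (\<Sum>j<length us. a j *\<^sub>R us ! j) (us ! i) = (\<Sum>j<length us. a j * h (us ! j) (us ! i))"
    using assms by (intro h_sum_left) auto
  also have "\<dots> = (\<Sum>j<length us. if j = i then a i else 0)"
    using assms by (intro sum.cong) (auto simp: orthonormal_def)
  finally show ?thesis using assms by simp
qed

lemma orthonormal_independent:
  assumes "orthonormal h us" "set us \<subseteq> T"
  shows "distinct us" "independent (set us)"
proof -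
  have *: "a i = 0" if "(\<Sum>j<length us. a j *\<^sub>R us ! j) = 0" "i < length us" for a i
    using orthonormal_coeff[OF assms that(2), of a] that nth_mem_subset[OF assms(2)] by simp
  then show "distinct us" by (rule distinct_independentI)
  show "independent (set us)" using * by (rule distinct_independentI)
qed

section \<open>Orthogonal projection and Gram-Schmidt\<close>

lemma orthonormal_projection:
  assumes "orthonormal h us" "set us \<subseteq> T" "y \<in> T"
  obtains p where "p \<in> span (set us)" "\<And>x. x \<in> span (set us) \<Longrightarrow> h y x = h p x"
proof
  define p where "p = (\<Sum>i<length us. h y (us ! i) *\<^sub>R us ! i)"
  show p: "p \<in> span (set us)" unfolding p_def by (rule span_sum, rule span_scale, rule span_base) simp
  have sub: "span (set us) \<subseteq> T" using assms(2) subspace_T by (rule span_minimal)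
  have pT: "p \<in> T" using p sub by blast
  fix x assume "x \<in> span (set us)"
  \<comment> \<open>Membership in \<open>T\<close> is carried through the induction because
    bilinearity is available only there.\<close>
  then have "x \<in> T \<and> h y x = h p x"
  proof (induction rule: span_induct_alt)
    case base
    show ?case using assms(3) pT by simp
  next
    case (step c z x)
    then obtain i where i: "i < length us" "us ! i = z" by (auto simp: in_set_conv_nth)
    have "h y z = h p z"
      using orthonormal_coeff[OF assms(1,2) i(1), of "\<lambda>i. h y (us ! i)"] i by (simp add: p_def)
    moreover have "z \<in> T" using step assms(2) by blast
    ultimately show ?case using assms(3) pT step by simp
  qed
  then show "h y x = h p x" by simp
qed

lemma normalize:
  assumes "w \<in> T" "w \<noteq> 0"
  shows "(1 / sqrt (h w w)) *\<^sub>R w \<in> T" "h ((1 / sqrt (h w w)) *\<^sub>R w) ((1 / sqrt (h w w)) *\<^sub>R w) = 1"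
  using assms h_pos[OF assms] by (auto simp: field_simps)

text \<open>One Gram-Schmidt step: a vector outside the span minus its projection is nonzero and
  orthogonal to the span, and can be normalised.\<close>

lemma orthonormal_complement:
  assumes "subspace V" "V \<subseteq> T" "orthonormal h us" "set us \<subseteq> V" "\<not> V \<subseteq> span (set us)"
  obtains u where "u \<in> V" "h u u = 1" "\<And>x. x \<in> span (set us) \<Longrightarrow> h u x = 0"
proof -
  obtain v where v: "v \<in> V" "v \<notin> span (set us)" using assms(5) by blast
  have usT: "set us \<subseteq> T" using assms by blast
  have sub: "span (set us) \<subseteq> T" using usT subspace_T by (rule span_minimal)
  have vT: "v \<in> T" using v assms by blast
  obtain p where p: "p \<in> span (set us)" "\<And>x. x \<in> span (set us) \<Longrightarrow> h v x = h p x"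
    using orthonormal_projection[OF assms(3) usT vT] by blast
  have pV: "p \<in> V" using p(1) span_minimal[OF assms(4,1)] by blast
  define w where "w = v - p"
  have w: "w \<in> T" "w \<noteq> 0" "w \<in> V"
    using v p pV assms by (auto simp: w_def subspace_diff subset_iff)
  define u where "u = (1 / sqrt (h w w)) *\<^sub>R w"
  show thesis
  proof
    show "u \<in> V" using w assms(1) by (simp add: u_def subspace_scale)
    show "h u u = 1" unfolding u_def by (rule normalize(2)[OF w(1,2)])
    fix x assume x: "x \<in> span (set us)"
    then have "h w x = 0" using p vT sub by (auto simp: w_def subset_iff)
    then show "h u x = 0" using x sub w by (auto simp: u_def subset_iff)
  qed
qed

lemma orthonormal_length:
  assumes "ordered_basis V bs" "V \<subseteq> T" "orthonormal h us" "set us \<subseteq> V"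
  shows "length us \<le> length bs"
proof -
  have "independent (set us)" "distinct us" using orthonormal_independent assms by blast+
  moreover have "set us \<subseteq> span (set bs)" using assms by (simp add: ordered_basis_def)
  ultimately have "card (set us) \<le> card (set bs)"
    using real_vector.independent_span_bound[of "set bs" "set us"] by auto
  then show ?thesis using \<open>distinct us\<close> card_length[of bs] by (simp add: distinct_card)
qed

lemma orthonormal_ordered_basis:
  assumes "subspace V" "V \<subseteq> T" "orthonormal h us" "set us \<subseteq> V" "V \<subseteq> span (set us)"
  shows "ordered_basis V us"
proof -
  have "distinct us" "independent (set us)" using orthonormal_independent[of us] assms by blast+
  moreover have "span (set us) = V" using assms span_minimal by blast
  ultimately show ?thesis by (simp add: ordered_basis_def)
qed

text \<open>Gram-Schmidt as an induction on the number of missing vectors; the length of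
  \<open>bs\<close> bounds that of every orthonormal list in \<open>V\<close>, so the process
  stops.\<close>

lemma orthonormal_extend:
  assumes "ordered_basis V bs" "V \<subseteq> T" "orthonormal h us" "set us \<subseteq> V"
  shows "\<exists>ws. orthonormal h (us @ ws) \<and> ordered_basis V (us @ ws)"
  using assms(3,4)
proof (induction "length bs - length us" arbitrary: us rule: less_induct)
  case less
  have V: "subspace V" using assms(1) by (rule ordered_basis_subspace)
  show ?case
  proof (cases "V \<subseteq> span (set us)")
    case True
    then have "ordered_basis V us" using orthonormal_ordered_basis V assms(2) less.prems by blast
    then show ?thesis using less.prems by (intro exI[of _ "[]"]) simp
  next
    case False
    then obtain u where u: "u \<in> V" "h u u = 1" "\<And>x. x \<in> span (set us) \<Longrightarrow> h u x = 0"
      using orthonormal_complement[OF V assms(2) less.prems] by blast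
    have "h u x = 0 \<and> h x u = 0" if "x \<in> set us" for x
      using u(3)[OF span_base[OF that]] h_sym[of u x] u(1) that less.prems(2) assms(2) by auto
    then have *: "orthonormal h (us @ [u])" "set (us @ [u]) \<subseteq> V"
      using less.prems u by (simp_all add: orthonormal_append_iff)
    have "length bs - length (us @ [u]) < length bs - length us"
      using orthonormal_length[OF assms(1,2) *] by simp
    from less.hyps[OF this *] show ?thesis by auto
  qed
qed

lemma orthonormal_imp_ordered_basis:
  assumes "ordered_basis V bs" "V \<subseteq> T" "orthonormal h us" "set us \<subseteq> V" "length us = length bs"
  shows "ordered_basis V us"
proof -
  obtain ws where ws: "ordered_basis V (us @ ws)" using orthonormal_extend[OF assms(1-4)] by blast
  then have "length (us @ ws) = length bs"
    using ordered_basis_length[OF assms(1)] ordered_basis_length[OF ws] by simp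
  then show ?thesis using ws assms(5) by simp
qed

text \<open>The change-of-basis matrix is orthogonal. Consequently the absolute value of a form of
  top degree on \<open>V\<close> is the same on all orthonormal bases.\<close>

lemma abs_det_change_of_orthonormal_basis:
  assumes "ordered_basis V bs" "V \<subseteq> T" "orthonormal h bs" "ordered_basis V cs" "orthonormal h cs"
  shows "\<bar>Determinant.det (change_of_basis bs cs)\<bar> = 1"
proof -
  let ?m = "length bs" and ?C = "change_of_basis bs cs"
  have len: "length cs = ?m"
    using ordered_basis_length[OF assms(1)] ordered_basis_length[OF assms(4)] by simp
  have bsT: "set bs \<subseteq> T" and csV: "set cs \<subseteq> V"
    using ordered_basis_subset[OF assms(1)] ordered_basis_subset[OF assms(4)] assms(2) by auto
  have cs: "cs ! i = (\<Sum>l<?m. ?C $$ (i, l) *\<^sub>R bs ! l)" if "i < ?m" for i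
    using arg_cong[OF change_of_basis_expansion[OF assms(1) csV len], of "\<lambda>xs. xs ! i"] that by simp
  have entry: "(\<Sum>l<?m. ?C $$ (i, l) * ?C $$ (j, l)) = (if i = j then 1 else 0)" if ij: "i < ?m" "j < ?m" for i j
  proof -
    have "(if i = j then 1 else 0) = h (cs ! i) (cs ! j)"
      using assms(5) ij len by (simp add: orthonormal_def)
    also have "\<dots> = h (cs ! i) (\<Sum>l<?m. ?C $$ (j, l) *\<^sub>R bs ! l)" using cs[OF ij(2)] by simp
    also have "\<dots> = (\<Sum>l<?m. ?C $$ (j, l) * h (cs ! i) (bs ! l))"
      using bsT nth_mem_subset[OF csV, of i] assms(2) ij len by (intro h_sum_right) auto
    also have "\<dots> = (\<Sum>l<?m. ?C $$ (i, l) * ?C $$ (j, l))"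
    proof (rule sum.cong[OF refl])
      fix l assume "l \<in> {..<?m}"
      then have "h (cs ! i) (bs ! l) = ?C $$ (i, l)"
        using orthonormal_coeff[OF assms(3) bsT, of l "\<lambda>l. ?C $$ (i, l)"] cs[OF ij(1)] by simp
      then show "?C $$ (j, l) * h (cs ! i) (bs ! l) = ?C $$ (i, l) * ?C $$ (j, l)" by simp
    qed
    finally show ?thesis ..
  qed
  have C: "?C \<in> carrier_mat ?m ?m" by simp
  have "?C * transpose_mat ?C = 1\<^sub>m ?m"
  proof (rule eq_matI)
    fix i j assume "i < dim_row (1\<^sub>m ?m :: real mat)" "j < dim_col (1\<^sub>m ?m :: real mat)"
    then show "(?C * transpose_mat ?C) $$ (i, j) = (1\<^sub>m ?m :: real mat) $$ (i, j)"
      using entry[of i j] carrier_matD[OF C]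
      by (simp add: scalar_prod_def atLeast0LessThan)
  qed (use carrier_matD[OF C] in auto)
  then have "Determinant.det ?C * Determinant.det ?C = 1"
    using det_mult[OF C, of "transpose_mat ?C"] det_transpose[OF C] by simp
  then show ?thesis by (metis abs_mult_self_eq abs_one abs_square_eq_1 power2_eq_square)
qed

text \<open>It ensures that the choice in \<open>plane_value\<close> is made from a nonempty set. If
  an orthonormal basis has the wrong orientation, its first vector is negated.\<close>

lemma orthonormal_in_orientation:
  assumes bs: "ordered_basis V bs" and "V \<subseteq> T"
  shows "\<exists>cs\<in>orientation_of bs. orthonormal h cs"
proof -
  obtain cs where on: "orthonormal h cs" and cs: "ordered_basis V cs"
    using orthonormal_extend[OF assms, of "[]"] by auto
  have len: "length cs = length bs"
    using ordered_basis_length[OF bs] ordered_basis_length[OF cs] by simp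
  consider "Determinant.det (change_of_basis bs cs) > 0" | "Determinant.det (change_of_basis bs cs) < 0"
    using det_change_of_basis_nonzero[OF bs cs] by linarith
  then show ?thesis
  proof cases
    case 1
    then show ?thesis using on cs bs by (auto simp: orientation_of_eq)
  next
    case 2
    let ?C = "change_of_basis bs cs"
    let ?m = "length bs"
    have C: "?C \<in> carrier_mat ?m ?m" by simp
    \<comment> \<open>The empty matrix has determinant 1, so a negative determinant guarantees that
      there is a first vector.\<close>
    have m: "0 < ?m" using 2 det_dim_zero[of ?C] C by (cases "?m = 0") auto
    let ?ds = "cs[0 := - (cs ! 0)]"
    have csV: "set cs \<subseteq> V" using ordered_basis_subset[OF cs] .
    have csT: "cs ! i \<in> T" if "i < ?m" for i using nth_mem_subset[OF csV, of i] assms(2) that len by auto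
    have "orthonormal h ?ds"
      unfolding orthonormal_def
    proof (intro allI impI)
      fix i j assume "i < length ?ds" "j < length ?ds"
      then show "h (?ds ! i) (?ds ! j) = (if i = j then 1 else 0)"
        using on csT len m unfolding orthonormal_def by (auto simp: nth_list_update)
    qed
    moreover have "set ?ds \<subseteq> V"
    proof -
      have "- (cs ! 0) \<in> V" using csV m len ordered_basis_subspace[OF bs] by (auto intro!: subspace_neg)
      then show ?thesis using csV set_update_subset_insert by fastforce
    qed
    ultimately have "ordered_basis V ?ds"
      using orthonormal_imp_ordered_basis[OF assms] len by simp
    moreover have "change_of_basis bs ?ds = multrow 0 (- 1) ?C"
    proof (rule change_of_basis_eqI[OF bs])
      show "?ds = map (\<lambda>i. \<Sum>j<?m. multrow 0 (- 1) ?C $$ (i, j) *\<^sub>R bs ! j) [0..<?m]"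
      proof (rule nth_equalityI)
        fix i assume "i < length ?ds"
        then have i: "i < ?m" using len by simp
        have "cs ! i = (\<Sum>l<?m. ?C $$ (i, l) *\<^sub>R bs ! l)"
          using arg_cong[OF change_of_basis_expansion[OF bs csV len], of "\<lambda>xs. xs ! i"] i by simp
        moreover have "?ds ! i = (if i = 0 then - (cs ! i) else cs ! i)"
          using i len by (cases cs) (auto simp: nth_Cons split: nat.split)
        ultimately have "?ds ! i = (\<Sum>j<?m. (if i = 0 then - ?C $$ (i, j) else ?C $$ (i, j)) *\<^sub>R bs ! j)"
          by (cases "i = 0") (simp_all only: simp_thms if_True if_False scaleR_minus_left sum_negf)
        also have "\<dots> = (\<Sum>j<?m. multrow 0 (- 1) ?C $$ (i, j) *\<^sub>R bs ! j)"
          using i carrier_matD[OF C] by (intro sum.cong arg_cong2[of _ _ _ _ scaleR] refl) simp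
        finally show "?ds ! i = map (\<lambda>i. \<Sum>j<?m. multrow 0 (- 1) ?C $$ (i, j) *\<^sub>R bs ! j) [0..<?m] ! i"
          using i by simp
      qed (use len in simp)
    qed (use len C in auto)
    then have "Determinant.det (change_of_basis bs ?ds) > 0"
      using det_multrow[OF m C, of "- 1"] 2 by simp
    ultimately show ?thesis using \<open>orthonormal h ?ds\<close> by (auto simp: orientation_of_eq[OF bs])
  qed
qed

end

subsection \<open>Wirtinger's inequality and its equality case\<close>

locale hermitian_space = euclidean_subspace T h
  for T :: "'v::real_vector set" and h :: "'v \<Rightarrow> 'v \<Rightarrow> real" +
  fixes J :: "'v \<Rightarrow> 'v"
  assumes J_closed [simp, intro]: "\<And>x. x \<in> T \<Longrightarrow> J x \<in> T"
    and J_linear: "\<And>x y a b. x \<in> T \<Longrightarrow> y \<in> T \<Longrightarrow> J (a *\<^sub>R x + b *\<^sub>R y) = a *\<^sub>R J x + b *\<^sub>R J y"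
    and J_squared [simp]: "\<And>x. x \<in> T \<Longrightarrow> J (J x) = - x"
    and hermitian [simp]: "\<And>x y. x \<in> T \<Longrightarrow> y \<in> T \<Longrightarrow> h (J x) (J y) = h x y"
begin

lemma J_simps [simp]:
  assumes "x \<in> T"
  shows "y \<in> T \<Longrightarrow> J (x + y) = J x + J y" "y \<in> T \<Longrightarrow> J (x - y) = J x - J y"
    "J (- x) = - J x" "J (a *\<^sub>R x) = a *\<^sub>R J x"
  using J_linear[OF assms, of y 1 1] J_linear[OF assms, of y 1 "- 1"]
    J_linear[OF assms assms, of "- 1" 0] J_linear[OF assms assms, of a 0] by simp_all

lemma J_zero [simp]: "J 0 = 0"
  using J_simps(4)[of 0 0] by simp

lemma h_J_skew: "x \<in> T \<Longrightarrow> y \<in> T \<Longrightarrow> h x (J y) = - h (J x) y"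
  using hermitian[of x "J y"] by simp

lemma h_J_self [simp]: "x \<in> T \<Longrightarrow> h (J x) x = 0" "x \<in> T \<Longrightarrow> h x (J x) = 0"
  using h_J_skew[of x x] h_sym[of "J x" x] by auto

definition kaehler :: "'v list \<Rightarrow> real" where
  "kaehler vs = h (vs ! 0) (J (vs ! 1))"

definition kaehler_pow :: "nat \<Rightarrow> 'v list \<Rightarrow> real" where
  "kaehler_pow k = divided_power kaehler k"

lemma kaehler_pair [simp]: "kaehler [x, y] = h x (J y)"
  by (simp add: kaehler_def)

lemma kaehler_pow_0 [simp]: "kaehler_pow 0 vs = 1"
  by (simp add: kaehler_pow_def)

lemma alternating_form_kaehler_pow: "alternating_form T (2 * k) (kaehler_pow k)"
  unfolding kaehler_pow_def
  by (rule alternating_form_divided_power) (auto simp: algebra_simps)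

lemma kaehler_pow_change_of_basis:
  assumes "ordered_basis V bs" "V \<subseteq> T" "length bs = 2 * k" "set cs \<subseteq> V" "length cs = 2 * k"
  shows "kaehler_pow k cs = Determinant.det (change_of_basis bs cs) * kaehler_pow k bs"
  using alternating_form_change_of_basis[OF subspace_T alternating_form_kaehler_pow assms] .

text \<open>The skewness required by the expansion is the skew-adjointness of
  \<open>J\<close>.\<close>

lemma kaehler_pow_expand:
  assumes "set (u # w # ws) \<subseteq> T" "length ws = 2 * k" "\<And>x. x \<in> set ws \<Longrightarrow> h u (J x) = 0"
  shows "kaehler_pow (Suc k) (u # w # ws) = h u (J w) * kaehler_pow k ws"
proof -
  have "h x (J u) = - h u (J x)" if "x \<in> set (u # w # ws)" for x
  proof -
    have "x \<in> T" "u \<in> T" using that assms(1) by auto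
    then show ?thesis using h_J_skew[of x u] h_sym[of "J x" u] by simp
  qed
  then show ?thesis
    unfolding kaehler_pow_def using divided_power_expand[of u w ws kaehler k] assms(2,3) by simp
qed

text \<open>The two vectors \<open>u\<close> and \<open>w\<close>, with \<open>w\<close> parallel to the projection of \<open>J u\<close>, split off from the
  other vectors, because \<open>\<Omega>(u, \<cdot>)\<close> vanishes on all of them.\<close>
lemma kaehler_pow_reduction:
  assumes vs: "orthonormal h vs" "set vs \<subseteq> T" "length vs = 2 * Suc k"
    and u: "u \<in> span (set vs)" "h u u = 1"
  obtains w ws where "set (u # w # ws) \<subseteq> span (set vs)" "orthonormal h (u # w # ws)" "length ws = 2 * k"
    "\<bar>kaehler_pow (Suc k) vs\<bar> = \<bar>h (J u) w\<bar> * \<bar>kaehler_pow k ws\<bar>"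
proof -
  let ?V = "span (set vs)"
  have VT: "?V \<subseteq> T" using vs(2) subspace_T by (rule span_minimal)
  have basis: "ordered_basis ?V vs"
    using orthonormal_ordered_basis[OF _ VT vs(1)] by (simp add: span_superset)
  have uT: "u \<in> T" using u VT by blast
  obtain p where p: "p \<in> ?V" "\<And>x. x \<in> ?V \<Longrightarrow> h (J u) x = h p x"
    using orthonormal_projection[OF vs(1,2), of "J u"] uT by blast
  have pT: "p \<in> T" using p VT by blast
  \<comment> \<open>Since \<open>J u\<close> is orthogonal to \<open>u\<close>, so is its projection
    \<open>p\<close>; hence \<open>u\<close> and the normalised \<open>p\<close> can begin an
    orthonormal list.\<close>
  have "h p u = 0" using p(2)[OF u(1)] uT by simp
  obtain us where us: "orthonormal h us" "set us \<subseteq> ?V" "length us = 2 * Suc k" "us ! 0 = u"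
    "\<And>i. 2 \<le> i \<Longrightarrow> i < 2 * Suc k \<Longrightarrow> h p (us ! i) = 0" "ordered_basis ?V us"
  proof (cases "p = 0")
    \<comment> \<open>Here \<open>J u\<close> is orthogonal to the whole span, so every orthonormal
      completion of \<open>u\<close> will do.\<close>
    case True
    have "orthonormal h [u]" "set [u] \<subseteq> ?V" using u by simp_all
    then obtain ws where ws: "orthonormal h ([u] @ ws)" "ordered_basis ?V ([u] @ ws)"
      using orthonormal_extend[OF basis VT] by blast
    show thesis
    proof (rule that[OF ws(1) ordered_basis_subset[OF ws(2)] _ _ _ ws(2)])
      show len: "length ([u] @ ws) = 2 * Suc k"
        using ordered_basis_length[OF ws(2)] ordered_basis_length[OF basis] vs(3) by simp
      fix i assume "2 \<le> i" "i < 2 * Suc k"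
      have "set ([u] @ ws) \<subseteq> T" using ordered_basis_subset[OF ws(2)] VT by (rule subset_trans)
      then have "([u] @ ws) ! i \<in> T" using len \<open>i < 2 * Suc k\<close> by (intro nth_mem_subset) simp_all
      then show "h p (([u] @ ws) ! i) = 0" using True by simp
    qed simp
  next
    case False
    define c where "c = 1 / sqrt (h p p)"
    define q where "q = c *\<^sub>R p"
    have q: "q \<in> T" "h q q = 1" "q \<in> ?V"
      using normalize[OF pT False] p(1) by (simp_all add: q_def c_def span_scale)
    have "h q u = 0" using \<open>h p u = 0\<close> pT uT by (simp add: q_def)
    then have on: "orthonormal h [u, q]"
      using u q uT h_sym[of u q] by (simp add: orthonormal_Cons_iff)
    have "set [u, q] \<subseteq> ?V" using u q by simp
    then obtain ws where ws: "orthonormal h ([u, q] @ ws)" "ordered_basis ?V ([u, q] @ ws)"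
      using orthonormal_extend[OF basis VT on] by blast
    have perp: "h p x = 0" if "x \<in> set ws" for x
    proof -
      have "h q x = 0" using ws(1) that by (simp add: orthonormal_Cons_iff)
      moreover have "x \<in> T" using ordered_basis_subset[OF ws(2)] VT that by auto
      moreover have "c \<noteq> 0" using h_pos[OF pT False] by (simp add: c_def)
      ultimately show ?thesis using pT by (simp add: q_def)
    qed
    show thesis
    proof (rule that[OF ws(1) ordered_basis_subset[OF ws(2)] _ _ _ ws(2)])
      show len: "length ([u, q] @ ws) = 2 * Suc k"
        using ordered_basis_length[OF ws(2)] ordered_basis_length[OF basis] vs(3) by simp
      fix i assume i: "2 \<le> i" "i < 2 * Suc k"
      then have "([u, q] @ ws) ! i = ws ! (i - 2)" "i - 2 < length ws"
        using len by (auto simp: nth_append numeral_2_eq_2)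
      then show "h p (([u, q] @ ws) ! i) = 0" using perp nth_mem by metis
    qed simp
  qed
  \<comment> \<open>The case rule distinguishes lists by their first two entries; the length of
    \<open>us\<close> leaves only the case with both present.\<close>
  then obtain w ws where ws: "us = u # w # ws" by (cases us rule: remdups_adj.cases) auto
  have len: "length ws = 2 * k" using us(3) ws by simp
  have zero: "h u (J x) = 0" if x: "x \<in> set ws" for x
  proof -
    obtain i where "i < length ws" "ws ! i = x" using x by (auto simp: in_set_conv_nth)
    then have "h p x = 0" using us(5)[of "i + 2"] ws len by auto
    moreover have "x \<in> ?V" using x us(2) ws by auto
    ultimately show ?thesis using p(2)[of x] h_J_skew[OF uT] VT by auto
  qed
  have wT: "w \<in> T" and "set us \<subseteq> T" using us(2) ws VT by auto
  \<comment> \<open>The adapted basis \<open>us\<close> may have the opposite orientation to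
    \<open>vs\<close>, which is why only absolute values are compared.\<close>
  have "kaehler_pow (Suc k) us = Determinant.det (change_of_basis vs us) * kaehler_pow (Suc k) vs"
    using kaehler_pow_change_of_basis[OF basis VT vs(3) us(2,3)] .
  then have "\<bar>kaehler_pow (Suc k) vs\<bar> = \<bar>kaehler_pow (Suc k) us\<bar>"
    using abs_det_change_of_orthonormal_basis[OF basis VT vs(1) us(6) us(1)] by (simp add: abs_mult)
  also have "\<dots> = \<bar>h (J u) w\<bar> * \<bar>kaehler_pow k ws\<bar>"
    using kaehler_pow_expand[of u w ws k] \<open>set us \<subseteq> T\<close> len zero h_J_skew[OF uT wT] ws by (simp add: abs_mult)
  finally show thesis using that[of w ws] us(1,2) ws len by simp
qed

text \<open>Both claims follow from one identity: the vector \<open>x - h x y *\<^sub>R y\<close>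
  has squared length \<open>1 - (h x y)\<^sup>2\<close>, which is nonnegative and vanishes only for
  the zero vector.\<close>

lemma cauchy_schwarz_unit:
  assumes "x \<in> T" "y \<in> T" "h x x = 1" "h y y = 1"
  shows "\<bar>h x y\<bar> \<le> 1" "\<bar>h x y\<bar> = 1 \<Longrightarrow> x = h x y *\<^sub>R y"
proof -
  let ?c = "h x y" and ?z = "x - h x y *\<^sub>R y"
  have z: "?z \<in> T" using assms by simp
  have eq: "h ?z ?z = 1 - ?c\<^sup>2"
    using assms h_sym[of y x] by (simp add: algebra_simps power2_eq_square)
  then show "\<bar>?c\<bar> \<le> 1" using h_nonneg[OF z] by (simp add: abs_square_le_1)
  assume "\<bar>?c\<bar> = 1"
  then have "?c\<^sup>2 = 1" by (metis power2_abs one_power2)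
  then have "h ?z ?z = 0" using eq by simp
  then have "?z = 0" using h_pos[OF z] by force
  then show "x = ?c *\<^sub>R y" by simp
qed

lemma abs_kaehler_pow_le_1:
  assumes "orthonormal h vs" "set vs \<subseteq> T" "length vs = 2 * k"
  shows "\<bar>kaehler_pow k vs\<bar> \<le> 1"
  using assms
proof (induction k arbitrary: vs)
  case 0
  then show ?case by simp
next
  case (Suc k)
  let ?u = "vs ! 0"
  have "?u \<in> set vs" "h ?u ?u = 1" using Suc.prems by (auto simp: orthonormal_def)
  then obtain w ws where ws: "set (?u # w # ws) \<subseteq> span (set vs)" "orthonormal h (?u # w # ws)" "length ws = 2 * k"
    "\<bar>kaehler_pow (Suc k) vs\<bar> = \<bar>h (J ?u) w\<bar> * \<bar>kaehler_pow k ws\<bar>"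
    using kaehler_pow_reduction[OF Suc.prems] span_base by metis
  have T: "set (?u # w # ws) \<subseteq> T" using ws(1) span_minimal[OF Suc.prems(2) subspace_T] by blast
  have "\<bar>h (J ?u) w\<bar> \<le> 1"
    using T ws(2) by (intro cauchy_schwarz_unit) (auto simp: orthonormal_Cons_iff)
  moreover have "\<bar>kaehler_pow k ws\<bar> \<le> 1"
    using T ws by (intro Suc.IH) (auto simp: orthonormal_Cons_iff)
  ultimately show ?case using ws(4) by (simp add: mult_le_one)
qed

text \<open>The reduction accepts any unit vector of the span, not just a member of
  \<open>vs\<close>; this freedom turns a single equation into invariance in every direction
  \<open>v\<close>.\<close>

lemma abs_kaehler_pow_eq_1_imp_invariant:
  assumes "orthonormal h vs" "set vs \<subseteq> T" "length vs = 2 * k" "\<bar>kaehler_pow k vs\<bar> = 1"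
  shows "J ` span (set vs) \<subseteq> span (set vs)"
proof
  let ?V = "span (set vs)"
  have VT: "?V \<subseteq> T" using assms(2) subspace_T by (rule span_minimal)
  fix y assume "y \<in> J ` ?V"
  then obtain v where v: "v \<in> ?V" "y = J v" by blast
  show "y \<in> ?V"
  proof (cases "v = 0")
    case True
    then show ?thesis using v span_zero by simp
  next
    case False
    have vT: "v \<in> T" using v VT by blast
    \<comment> \<open>The empty list spans only 0, so a nonzero \<open>v\<close> forces at least one
      pair.\<close>
    have "k \<noteq> 0" using v False assms(3) by (cases k) auto
    then obtain l where k: "k = Suc l" by (cases k) auto
    define s where "s = 1 / sqrt (h v v)"
    define u where "u = s *\<^sub>R v"
    have s: "s \<noteq> 0" using h_pos[OF vT False] by (simp add: s_def)
    have u: "u \<in> ?V" "h u u = 1" "u \<in> T"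
      using v normalize[OF vT False] by (auto simp: u_def s_def span_scale)
    obtain w ws where ws: "set (u # w # ws) \<subseteq> ?V" "orthonormal h (u # w # ws)" "length ws = 2 * l"
      "\<bar>kaehler_pow k vs\<bar> = \<bar>h (J u) w\<bar> * \<bar>kaehler_pow l ws\<bar>"
      using kaehler_pow_reduction[OF assms(1,2) assms(3)[unfolded k] u(1,2)] k by metis
    have T: "w \<in> T" "set ws \<subseteq> T" "h w w = 1" using ws VT by (auto simp: orthonormal_Cons_iff)
    have "\<bar>h (J u) w\<bar> \<le> 1" using T u by (intro cauchy_schwarz_unit) auto
    moreover have "\<bar>kaehler_pow l ws\<bar> \<le> 1"
      using T ws by (intro abs_kaehler_pow_le_1) (auto simp: orthonormal_Cons_iff)
    \<comment> \<open>A product of two numbers between 0 and 1 is 1 only if both are.\<close>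
    ultimately have "\<bar>h (J u) w\<bar> = 1"
      using ws(4) assms(4) mult_left_le[of "\<bar>kaehler_pow l ws\<bar>" "\<bar>h (J u) w\<bar>"] by simp
    then have "J u = h (J u) w *\<^sub>R w" using T u by (intro cauchy_schwarz_unit) auto
    moreover have "w \<in> ?V" using ws by simp
    ultimately have "J u \<in> ?V" by (metis span_scale)
    then have "(1 / s) *\<^sub>R J u \<in> ?V" by (rule span_scale)
    moreover have "(1 / s) *\<^sub>R J u = J v" using vT s by (simp add: u_def)
    ultimately show ?thesis using v by simp
  qed
qed

section \<open>Unitary bases and the complex orientation\<close>

lemma unitary_extend:
  assumes bs: "ordered_basis V bs" "V \<subseteq> T" and inv: "J ` V \<subseteq> V"
    and "orthonormal h (complex_flat J es)" "set es \<subseteq> V"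
  shows "\<exists>es. orthonormal h (complex_flat J es) \<and> ordered_basis V (complex_flat J es)"
  using assms(4,5)
proof (induction "length bs - length es" arbitrary: es rule: less_induct)
  case less
  let ?us = "complex_flat J es"
  have V: "subspace V" using bs(1) by (rule ordered_basis_subspace)
  have usV: "set ?us \<subseteq> V" using less.prems inv by (auto simp: set_complex_flat)
  show ?case
  proof (cases "V \<subseteq> span (set ?us)")
    case True
    then show ?thesis using orthonormal_ordered_basis[OF V bs(2) less.prems(1) usV] less.prems by blast
  next
    case False
    then obtain u where u: "u \<in> V" "h u u = 1" "\<And>x. x \<in> span (set ?us) \<Longrightarrow> h u x = 0"
      using orthonormal_complement[OF V bs(2) less.prems(1) usV] by blast
    have uT: "u \<in> T" "J u \<in> T" "J u \<in> V" using u bs(2) inv by auto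
    \<comment> \<open>The orthogonal complement of a complex subspace is again complex:
      skew-adjointness moves the \<open>J\<close> in \<open>J u\<close> to the other argument. So
      the pair \<open>J u\<close>, \<open>u\<close> can be appended at once.\<close>
    have *: "h u e = 0" "h e u = 0" "h u (J e) = 0" "h (J e) u = 0" "h (J u) e = 0" "h e (J u) = 0"
      if "e \<in> set es" for e
    proof -
      have e: "e \<in> T" "J e \<in> T" using that less.prems bs(2) by auto
      show ue: "h u e = 0" "h u (J e) = 0"
        using that u(3) by (auto intro!: span_base simp: set_complex_flat)
      then show "h e u = 0" "h (J e) u = 0" "h (J u) e = 0" "h e (J u) = 0"
        using h_sym[of u] h_J_skew[of u e] h_J_skew[of e u] e uT by auto
    qed
    have "orthonormal h (?us @ [J u, u])"
      using less.prems(1) u(2) uT * less.prems(2) bs(2)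
      by (auto simp: orthonormal_append_iff orthonormal_Cons_iff set_complex_flat subset_iff)
    then have on: "orthonormal h (complex_flat J (es @ [u]))" by simp
    have sub: "set (es @ [u]) \<subseteq> V" using less.prems u by simp
    have "set (complex_flat J (es @ [u])) \<subseteq> V" using usV u uT by simp
    then have "length (complex_flat J (es @ [u])) \<le> length bs"
      by (rule orthonormal_length[OF bs on])
    \<comment> \<open>The flat list grows by two per step while the measure counts
      \<open>es\<close>; the bound on the flat list keeps \<open>length es\<close> strictly below
      \<open>length bs\<close>.\<close>
    then have "length bs - length (es @ [u]) < length bs - length es"
      unfolding length_complex_flat by simp
    from less.hyps[OF this on sub] show ?thesis .
  qed
qed

text \<open>With \<open>J e\<close> placed before \<open>e\<close>, each pair splits off the factor
  \<open>h (J e) (J e) = 1\<close>; the opposite order would give -1.\<close>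

lemma kaehler_pow_unitary:
  assumes "orthonormal h (complex_flat J es)" "set es \<subseteq> T"
  shows "kaehler_pow (length es) (complex_flat J es) = 1"
  using assms
proof (induction es)
  case Nil
  then show ?case by simp
next
  case (Cons e es)
  have zero: "h (J e) (J x) = 0" if x: "x \<in> set (complex_flat J es)" for x
  proof -
    have "set (complex_flat J es) \<subseteq> T" using Cons.prems by (auto simp: set_complex_flat)
    then have "h (J e) (J x) = h e x" using x Cons.prems by auto
    then show ?thesis using x Cons.prems by (auto simp: orthonormal_Cons_iff)
  qed
  have "kaehler_pow (Suc (length es)) (J e # e # complex_flat J es) =
      h (J e) (J e) * kaehler_pow (length es) (complex_flat J es)"
    using Cons.prems zero
    by (intro kaehler_pow_expand) (auto simp: set_complex_flat length_complex_flat)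
  then show ?case using Cons by (simp add: orthonormal_Cons_iff)
qed

text \<open>Complex Gram-Schmidt with unnormalised vectors: once the other vectors are orthogonal to
  the complex line of \<open>e\<close>, the pair splits off the factor \<open>h e e\<close>. The
  weak inequality allows induction over arbitrary lists; strictness for bases is obtained afterwards
  from a nonvanishing determinant.\<close>

lemma kaehler_pow_complex_nonneg:
  assumes "set es \<subseteq> T"
  shows "kaehler_pow (length es) (complex_flat J es) \<ge> 0"
  using assms
proof (induction "length es" arbitrary: es)
  case 0
  then show ?case by simp
next
  case (Suc k)
  then obtain e es' where es: "es = e # es'" "length es' = k" by (cases es) auto
  have e: "e \<in> T" "set es' \<subseteq> T" using Suc.prems es by auto
  show ?case
  proof (cases "e = 0")
    \<comment> \<open>For \<open>e = 0\<close> the orthogonality condition holds trivially and the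
      factor split off is 0.\<close>
    case True
    have "kaehler_pow (Suc k) (J e # e # complex_flat J es') = h (J e) (J e) * kaehler_pow k (complex_flat J es')"
      using True e es(2) by (intro kaehler_pow_expand) (auto simp: set_complex_flat length_complex_flat)
    then show ?thesis using True es by simp
  next
    case False
    \<comment> \<open>These are the coordinates of the orthogonal projection to the complex line of
      \<open>e\<close>. Both have the denominator \<open>h e e\<close>, because \<open>J e\<close>
      has the same length as \<open>e\<close>.\<close>
    define c where "c x = h x e / h e e" for x
    define d where "d x = h x (J e) / h e e" for x
    define r where "r x = x - c x *\<^sub>R e - d x *\<^sub>R J e" for x
    have pos: "h e e > 0" using h_pos[OF e(1) False] .
    have rT: "r x \<in> T" if "x \<in> T" for x using that e by (simp add: r_def)
    have re: "h (r x) e = 0" "h (r x) (J e) = 0" if "x \<in> T" for x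
      using that e pos by (simp_all add: r_def c_def d_def)
    have Jr: "J (r x) = J x + d x *\<^sub>R e - c x *\<^sub>R J e" if "x \<in> T" for x
      using that e by (simp add: r_def)
    let ?fs = "map r es'"
    have fsT: "set ?fs \<subseteq> T" using e(2) rT by auto
    have "list_all2 (\<lambda>x y. \<exists>a b. y = x + a *\<^sub>R J e + b *\<^sub>R e) (complex_flat J xs) (complex_flat J (map r xs))"
      if "set xs \<subseteq> T" for xs
      using that
    proof (induction xs)
      case (Cons x xs)
      have "\<exists>a b. J (r x) = J x + a *\<^sub>R J e + b *\<^sub>R e"
        by (rule exI[of _ "- c x"], rule exI[of _ "d x"]) (use Cons.prems Jr in simp)
      moreover have "\<exists>a b. r x = x + a *\<^sub>R J e + b *\<^sub>R e"
        by (rule exI[of _ "- d x"], rule exI[of _ "- c x"]) (simp add: r_def)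
      ultimately show ?case using Cons by simp
    qed simp
    \<comment> \<open>Passing from \<open>x\<close> to \<open>r x\<close> changes both
      \<open>x\<close> and \<open>J x\<close> by combinations of \<open>J e\<close> and
      \<open>e\<close>, whose span is \<open>J\<close>-invariant, so all slots of the flat list are
      sheared along the first two.\<close>
    then have shear: "kaehler_pow (Suc k) (J e # e # [] @ complex_flat J ?fs) =
        kaehler_pow (Suc k) (J e # e # [] @ complex_flat J es')"
      using alternating_form_kaehler_pow[of "Suc k"] e es
      by (intro alternating_form_shear[OF subspace_T]) (auto simp: length_complex_flat set_complex_flat)
    have zero: "h (J e) (J x) = 0" if x: "x \<in> set (complex_flat J ?fs)" for x
    proof -
      obtain y where y: "y \<in> T" "x = J (r y) \<or> x = r y"
        using x e(2) by (auto simp: set_complex_flat)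
      then show ?thesis
        using re[OF y(1)] rT[OF y(1)] e h_sym[of e] h_J_skew[of e "r y"] h_J_skew[of "r y" e] h_sym[of "J e" "r y"]
        by auto
    qed
    have "kaehler_pow (Suc k) (J e # e # complex_flat J ?fs) = h (J e) (J e) * kaehler_pow k (complex_flat J ?fs)"
    proof (rule kaehler_pow_expand[OF _ _ zero])
      show "set (J e # e # complex_flat J ?fs) \<subseteq> T" using e fsT by (auto simp: set_complex_flat)
      show "length (complex_flat J ?fs) = 2 * k" by (simp only: length_complex_flat length_map es(2))
    qed
    moreover have "kaehler_pow k (complex_flat J ?fs) \<ge> 0"
      using Suc.hyps(1)[of ?fs] es fsT by simp
    then have "h (J e) (J e) * kaehler_pow k (complex_flat J ?fs) \<ge> 0"
      using pos e by (intro mult_nonneg_nonneg) simp_all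
    ultimately show ?thesis using shear es by simp
  qed
qed

text \<open>A complex coefficient is a pair of real ones. As \<open>J e\<close> precedes
  \<open>e\<close> in the flat list, imaginary parts sit at even positions and real parts at odd
  ones.\<close>

lemma complex_basis_iff:
  assumes V: "subspace V" "V \<subseteq> T" "J ` V \<subseteq> V"
  shows "complex_basis J V es \<longleftrightarrow> ordered_basis V (complex_flat J es)"
proof -
  let ?n = "length es" and ?bs = "complex_flat J es"
  have len: "length ?bs = 2 * ?n" by (rule length_complex_flat)
  have sum_eq: "(\<Sum>j<length ?bs. a j *\<^sub>R ?bs ! j) =
      (\<Sum>i<?n. complex_scale J (Complex (a (2 * i + 1)) (a (2 * i))) (es ! i))" for a
    unfolding len sum_even_odd[symmetric]
    by (rule sum.cong) (simp_all add: complex_flat_nth complex_scale_def del: One_nat_def)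
  define coeff where "coeff zs j = (if even j then Im (zs ! (j div 2)) else Re (zs ! (j div 2)))" for zs j
  have coeff: "Complex (coeff zs (2 * i + 1)) (coeff zs (2 * i)) = zs ! i" for zs i
    by (simp add: coeff_def)
  have sum_coeff: "(\<Sum>j<length ?bs. coeff zs j *\<^sub>R ?bs ! j) = (\<Sum>i<?n. complex_scale J (zs ! i) (es ! i))" for zs
    unfolding sum_eq coeff ..
  show ?thesis
  proof
    assume cb: "complex_basis J V es"
    show "ordered_basis V ?bs"
    proof (rule ordered_basisI[OF V(1)])
      show "set ?bs \<subseteq> V" using cb V by (auto simp: complex_basis_def set_complex_flat)
    next
      fix v assume "v \<in> V"
      then obtain zs where "v = (\<Sum>i<?n. complex_scale J (zs ! i) (es ! i))"
        using cb unfolding complex_basis_def by blast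
      then show "\<exists>a. v = (\<Sum>i<length ?bs. a i *\<^sub>R ?bs ! i)"
        by (intro exI[of _ "coeff zs"]) (simp only: sum_coeff)
    next
      fix a j assume a: "(\<Sum>i<length ?bs. a i *\<^sub>R ?bs ! i) = 0" and j: "j < length ?bs"
      let ?zs = "map (\<lambda>i. Complex (a (2 * i + 1)) (a (2 * i))) [0..<?n]"
      have 1: "0 = (\<Sum>i<?n. complex_scale J (?zs ! i) (es ! i))"
        using a unfolding sum_eq by simp
      have 2: "0 = (\<Sum>i<?n. complex_scale J (replicate ?n 0 ! i) (es ! i))"
        by (simp add: complex_scale_def)
      \<comment> \<open>Independence is the uniqueness of the expansion of 0, applied to the given
        coefficients and to the zero list.\<close>
      have "\<exists>!zs. length zs = ?n \<and> 0 = (\<Sum>i<?n. complex_scale J (zs ! i) (es ! i))"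
        using cb subspace_0[OF V(1)] unfolding complex_basis_def by blast
      moreover have "length ?zs = ?n" "length (replicate ?n (0::complex)) = ?n" by simp_all
      ultimately have eq: "?zs = replicate ?n 0" using 1 2 by blast
      have "a (2 * i + 1) = 0 \<and> a (2 * i) = 0" if "i < ?n" for i
        using arg_cong[OF eq, of "\<lambda>zs. zs ! i"] that by (simp add: complex_eq_iff)
      from this[of "j div 2"] j len show "a j = 0" by (cases "even j") auto
    qed
  next
    assume ob: "ordered_basis V ?bs"
    show "complex_basis J V es"
      unfolding complex_basis_def
    proof (intro conjI ballI)
      show "set es \<subseteq> V" using ordered_basis_subset[OF ob] by (auto simp: set_complex_flat)
      fix v assume v: "v \<in> V"
      show "\<exists>!zs. length zs = ?n \<and> v = (\<Sum>i<?n. complex_scale J (zs ! i) (es ! i))"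
      proof (rule ex_ex1I)
        let ?a = "\<lambda>j. representation (set ?bs) v (?bs ! j)"
        have "v = (\<Sum>i<?n. complex_scale J (map (\<lambda>i. Complex (?a (2 * i + 1)) (?a (2 * i))) [0..<?n] ! i) (es ! i))"
          using ordered_basis_expansion[OF ob v] unfolding sum_eq by simp
        then show "\<exists>zs. length zs = ?n \<and> v = (\<Sum>i<?n. complex_scale J (zs ! i) (es ! i))"
          by (intro exI[of _ "map (\<lambda>i. Complex (?a (2 * i + 1)) (?a (2 * i))) [0..<?n]"]) simp
      next
        fix zs zs'
        assume zs: "length zs = ?n \<and> v = (\<Sum>i<?n. complex_scale J (zs ! i) (es ! i))"
          and zs': "length zs' = ?n \<and> v = (\<Sum>i<?n. complex_scale J (zs' ! i) (es ! i))"
        then have eq: "(\<Sum>j<length ?bs. coeff zs j *\<^sub>R ?bs ! j) = (\<Sum>j<length ?bs. coeff zs' j *\<^sub>R ?bs ! j)"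
          unfolding sum_coeff by simp
        show "zs = zs'"
        proof (rule nth_equalityI)
          fix i assume "i < length zs"
          then have "2 * i < length ?bs" "2 * i + 1 < length ?bs" using zs len by auto
          then have "coeff zs (2 * i) = coeff zs' (2 * i)" "coeff zs (2 * i + 1) = coeff zs' (2 * i + 1)"
            using ordered_basis_coeffs_unique[OF ob eq] by blast+
          then show "zs ! i = zs' ! i" by (simp add: coeff_def complex_eq_iff)
        qed (use zs zs' in simp)
      qed
    qed
  qed
qed

lemma unitary_basis_exists:
  assumes "ordered_basis V bs" "V \<subseteq> T" "J ` V \<subseteq> V"
  obtains es where "orthonormal h (complex_flat J es)" "ordered_basis V (complex_flat J es)"
    "complex_basis J V es" "2 * length es = length bs" "kaehler_pow (length es) (complex_flat J es) = 1"
proof -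
  obtain es where es: "orthonormal h (complex_flat J es)" "ordered_basis V (complex_flat J es)"
    using unitary_extend[OF assms, of "[]"] by auto
  have "set es \<subseteq> T" using ordered_basis_subset[OF es(2)] assms(2) by (auto simp: set_complex_flat)
  then have "kaehler_pow (length es) (complex_flat J es) = 1"
    using es by (intro kaehler_pow_unitary)
  moreover have "2 * length es = length bs"
    using ordered_basis_length[OF es(2)] ordered_basis_length[OF assms(1)] by (simp add: length_complex_flat)
  moreover have "complex_basis J V es"
    using complex_basis_iff[OF ordered_basis_subspace[OF assms(1)] assms(2,3)] es(2) by simp
  ultimately show thesis using that es by blast
qed

text \<open>On any complex basis the form is nonnegative by Gram-Schmidt, and nonzero because a
  nonvanishing determinant relates it to a unitary basis, where the value is 1. So all members of
  the union are the same class, and a unitary basis shows that the union is not empty.\<close>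

lemma complex_orientation_eq:
  assumes bs: "ordered_basis V bs" and V: "V \<subseteq> T" "J ` V \<subseteq> V" and len: "length bs = 2 * k"
  shows "complex_orientation J V = {cs. ordered_basis V cs \<and> kaehler_pow k cs > 0}"
proof -
  obtain us where us: "ordered_basis V (complex_flat J us)" "complex_basis J V us" "2 * length us = length bs"
    "kaehler_pow (length us) (complex_flat J us) = 1"
    using unitary_basis_exists[OF bs V] by blast
  have k: "length us = k" using us(3) len by simp
  have "orientation_of (complex_flat J es) = {cs. ordered_basis V cs \<and> kaehler_pow k cs > 0}"
    if "complex_basis J V es" for es
  proof -
    have es: "ordered_basis V (complex_flat J es)"
      using that complex_basis_iff[OF ordered_basis_subspace[OF bs] V] by simp
    have len_es: "length (complex_flat J es) = 2 * k"
      using ordered_basis_length[OF es] ordered_basis_length[OF bs] len by simp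
    then have k': "length es = k" by (simp add: length_complex_flat)
    have "set es \<subseteq> T" using that V by (auto simp: complex_basis_def)
    then have "kaehler_pow k (complex_flat J es) \<ge> 0" using kaehler_pow_complex_nonneg[of es] k' by simp
    moreover have "kaehler_pow k (complex_flat J es) \<noteq> 0"
      using kaehler_pow_change_of_basis[OF us(1) V(1) _ ordered_basis_subset[OF es] len_es]
        det_change_of_basis_nonzero[OF us(1) es] us(4) k by (simp add: length_complex_flat)
    ultimately have "kaehler_pow k (complex_flat J es) > 0" by simp
    then show ?thesis
      by (rule orientation_of_form[OF subspace_T alternating_form_kaehler_pow es V(1) len_es])
  qed
  then show ?thesis unfolding complex_orientation_def using us(2) by blast
qed

section \<open>Calibration inequality and contact set of a Hermitian space\<close>

lemma plane_value_kaehler: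
  assumes "\<xi> \<in> oriented_planes T (2 * k)"
  obtains V bs cs where "\<xi> = (V, orientation_of bs)" "ordered_basis V bs" "V \<subseteq> T" "length bs = 2 * k"
    "cs \<in> orientation_of bs" "orthonormal h cs" "plane_value h (kaehler_pow k) \<xi> = kaehler_pow k cs"
proof -
  obtain V bs where \<xi>: "\<xi> = (V, orientation_of bs)" "ordered_basis V bs" "V \<subseteq> T" "length bs = 2 * k"
    using assms by (auto simp: oriented_planes_def)
  \<comment> \<open>The basis returned by the choice operator stays arbitrary; the later arguments
    apply to every oriented orthonormal basis.\<close>
  let ?cs = "SOME cs. cs \<in> snd \<xi> \<and> orthonormal h cs"
  have "\<exists>cs. cs \<in> snd \<xi> \<and> orthonormal h cs"
    using orthonormal_in_orientation[OF \<xi>(2,3)] \<xi>(1) by auto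
  then have "?cs \<in> snd \<xi> \<and> orthonormal h ?cs" by (rule someI_ex)
  then have "?cs \<in> orientation_of bs" "orthonormal h ?cs" using \<xi>(1) by simp_all
  then show thesis by (rule that[OF \<xi>]) (simp only: plane_value_def)
qed

lemma plane_value_kaehler_le_1:
  assumes "\<xi> \<in> oriented_planes T (2 * k)"
  shows "plane_value h (kaehler_pow k) \<xi> \<le> 1"
proof -
  obtain V bs cs where \<xi>: "\<xi> = (V, orientation_of bs)" "ordered_basis V bs" "V \<subseteq> T" "length bs = 2 * k"
    "cs \<in> orientation_of bs" "orthonormal h cs" "plane_value h (kaehler_pow k) \<xi> = kaehler_pow k cs"
    by (rule plane_value_kaehler[OF assms])
  have cs: "ordered_basis V cs" using \<xi>(5) by (simp add: orientation_of_eq[OF \<xi>(2)])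
  then have "length cs = 2 * k" "set cs \<subseteq> T"
    using ordered_basis_length[OF cs] ordered_basis_length[OF \<xi>(2)] \<xi>(3,4) ordered_basis_subset[OF cs] by auto
  then show ?thesis using abs_kaehler_pow_le_1[OF \<xi>(6)] \<xi>(7) by fastforce
qed

lemma contact_planes:
  "{\<xi> \<in> oriented_planes T (2 * k). plane_value h (kaehler_pow k) \<xi> = 1} =
     (\<lambda>V. (V, complex_orientation J V)) ` complex_grassmannian J T k" (is "?L = ?R")
proof (rule Set.set_eqI, rule iffI)
  fix \<xi> assume "\<xi> \<in> ?L"
  then have *: "\<xi> \<in> oriented_planes T (2 * k)" "plane_value h (kaehler_pow k) \<xi> = 1" by auto
  obtain V bs cs where \<xi>: "\<xi> = (V, orientation_of bs)" "ordered_basis V bs" "V \<subseteq> T" "length bs = 2 * k"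
    "cs \<in> orientation_of bs" "orthonormal h cs" "plane_value h (kaehler_pow k) \<xi> = kaehler_pow k cs"
    by (rule plane_value_kaehler[OF *(1)])
  have one: "kaehler_pow k cs = 1" using * \<xi>(7) by simp
  have cs: "ordered_basis V cs" "Determinant.det (change_of_basis bs cs) > 0"
    using \<xi>(5) by (auto simp: orientation_of_eq[OF \<xi>(2)])
  have csT: "length cs = 2 * k" "set cs \<subseteq> T" "set cs \<subseteq> V" "span (set cs) = V"
    using ordered_basis_length[OF cs(1)] ordered_basis_length[OF \<xi>(2)] \<xi>(3,4)
      ordered_basis_subset[OF cs(1)] cs(1) by (auto simp: ordered_basis_def)
  have inv: "J ` V \<subseteq> V"
    using abs_kaehler_pow_eq_1_imp_invariant[OF \<xi>(6) csT(2,1)] one csT(4) by simp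
  obtain es where es: "complex_basis J V es" "2 * length es = length bs"
    using unitary_basis_exists[OF \<xi>(2,3) inv] by blast
  have "V \<in> complex_grassmannian J T k"
    using ordered_basis_subspace[OF cs(1)] \<xi>(3,4) inv es by (auto simp: complex_grassmannian_def)
  \<comment> \<open>The representative \<open>bs\<close> may fail to be orthonormal, but it is
    related to \<open>cs\<close> by a positive determinant and so inherits the sign that identifies
    the orientation.\<close>
  moreover have "1 = Determinant.det (change_of_basis bs cs) * kaehler_pow k bs"
    using kaehler_pow_change_of_basis[OF \<xi>(2,3,4) csT(3,1)] one by simp
  then have "kaehler_pow k bs > 0" using cs(2) zero_less_mult_pos[of "Determinant.det (change_of_basis bs cs)" "kaehler_pow k bs"] by simp
  then have "orientation_of bs = complex_orientation J V"
    using orientation_of_form[OF subspace_T alternating_form_kaehler_pow \<xi>(2,3,4)]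
      complex_orientation_eq[OF \<xi>(2,3) inv \<xi>(4)] by simp
  ultimately show "\<xi> \<in> ?R" using \<xi>(1) by blast
next
  fix \<xi> assume "\<xi> \<in> ?R"
  then obtain V where V: "\<xi> = (V, complex_orientation J V)" "V \<in> complex_grassmannian J T k" by blast
  then obtain es where es: "subspace V" "V \<subseteq> T" "J ` V \<subseteq> V" "length es = k" "complex_basis J V es"
    by (auto simp: complex_grassmannian_def)
  let ?bs = "complex_flat J es"
  have bs: "ordered_basis V ?bs" using complex_basis_iff[OF es(1-3)] es(5) by simp
  obtain us where us: "orthonormal h (complex_flat J us)" "ordered_basis V (complex_flat J us)"
    "complex_basis J V us" "2 * length us = length ?bs" "kaehler_pow (length us) (complex_flat J us) = 1"
    by (rule unitary_basis_exists[OF bs es(2,3)])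
  let ?us = "complex_flat J us"
  have len: "length ?us = 2 * k" "length us = k" using us(4) es(4) by (auto simp: length_complex_flat)
  have or: "complex_orientation J V = {cs. ordered_basis V cs \<and> kaehler_pow k cs > 0}"
    using complex_orientation_eq[OF us(2) es(2,3) len(1)] .
  then have "complex_orientation J V = orientation_of ?us"
    using orientation_of_form[OF subspace_T alternating_form_kaehler_pow us(2) es(2) len(1)] us(5) len by simp
  then have pl: "\<xi> \<in> oriented_planes T (2 * k)"
    using V(1) us(2) es(2) len(1) unfolding oriented_planes_def by blast
  obtain V' bs' cs where \<xi>: "\<xi> = (V', orientation_of bs')" "ordered_basis V' bs'" "V' \<subseteq> T"
    "length bs' = 2 * k" "cs \<in> orientation_of bs'" "orthonormal h cs"
    "plane_value h (kaehler_pow k) \<xi> = kaehler_pow k cs"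
    by (rule plane_value_kaehler[OF pl])
  have cs: "ordered_basis V cs" "kaehler_pow k cs > 0" using \<xi>(1,5) V(1) or by auto
  have "length cs = 2 * k" using ordered_basis_length[OF cs(1)] ordered_basis_length[OF us(2)] len by simp
  \<comment> \<open>Compared with the unitary basis, the determinant has absolute value 1, so the
    value is 1 or -1; belonging to the complex orientation rules out -1.\<close>
  then have "\<bar>kaehler_pow k cs\<bar> = 1"
    using kaehler_pow_change_of_basis[OF us(2) es(2) len(1) ordered_basis_subset[OF cs(1)]]
      abs_det_change_of_orthonormal_basis[OF us(2) es(2) us(1) cs(1) \<xi>(6)] us(5) len
    by (simp add: abs_mult)
  then show "\<xi> \<in> ?L" using pl \<xi>(7) cs(2) by simp
qed

end

subsection \<open>Smooth functions and tangent spaces\<close>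

text \<open>On an open set a derivative depends only on the values in that set. The closure
  properties of \<open>Ck_on\<close> use this to replace the derivative of a compound function by
  the formula of the corresponding differentiation rule.\<close>

lemma Ck_on_cong:
  assumes "open S" "\<And>x. x \<in> S \<Longrightarrow> f x = g x" "Ck_on k f S"
  shows "Ck_on k g S"
  using assms(2,3)
proof (induction k arbitrary: f g)
  case 0
  then show ?case using continuous_on_cong[of S S f g] by simp
next
  case (Suc k)
  have D: "(g has_derivative frechet_derivative f (at x)) (at x)" if "x \<in> S" for x
  proof -
    have "(f has_derivative frechet_derivative f (at x)) (at x)"
      using Suc.prems that by (auto simp: frechet_derivative_works)
    then show ?thesis
      using has_derivative_transform_within_open[OF _ assms(1) that] Suc.prems(1) by blast
  qed
  have "Ck_on k (\<lambda>x. frechet_derivative g (at x) v) S" for v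
  proof (rule Suc.IH)
    show "Ck_on k (\<lambda>x. frechet_derivative f (at x) v) S" using Suc.prems by simp
    show "frechet_derivative f (at x) v = frechet_derivative g (at x) v" if "x \<in> S" for x
      using frechet_derivative_at[OF D[OF that]] by simp
  qed
  moreover have "g differentiable (at x)" if "x \<in> S" for x
    using D[OF that] by (rule differentiableI)
  ultimately show ?case by simp
qed

lemma Ck_on_SucD: "Ck_on (Suc k) f S \<Longrightarrow> Ck_on k f S"
proof (induction k arbitrary: f)
  case 0
  then have "f differentiable_on S"
    by (auto simp: differentiable_on_def intro: differentiable_at_withinI)
  then show ?case by (simp add: differentiable_imp_continuous_on)
next
  case (Suc k)
  then show ?case by (metis Ck_on.simps(2))
qed

lemma Ck_on_const: "Ck_on k (\<lambda>x. c) S"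
  by (induction k arbitrary: c) (auto simp: frechet_derivative_const)

lemma Ck_on_add:
  assumes "open S" "Ck_on k f S" "Ck_on k g S"
  shows "Ck_on k (\<lambda>x. f x + g x) S"
  using assms(2,3)
proof (induction k arbitrary: f g)
  case 0
  then show ?case by (simp add: continuous_on_add)
next
  case (Suc k)
  have D: "((\<lambda>x. f x + g x) has_derivative
      (\<lambda>v. frechet_derivative f (at x) v + frechet_derivative g (at x) v)) (at x)" if "x \<in> S" for x
    using Suc.prems that
    by (intro has_derivative_add) (simp_all add: frechet_derivative_works[symmetric])
  have "Ck_on k (\<lambda>x. frechet_derivative (\<lambda>x. f x + g x) (at x) v) S" for v
  proof (rule Ck_on_cong[OF assms(1)])
    show "Ck_on k (\<lambda>x. frechet_derivative f (at x) v + frechet_derivative g (at x) v) S"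
      using Suc.prems by (intro Suc.IH) simp_all
    show "frechet_derivative f (at x) v + frechet_derivative g (at x) v =
        frechet_derivative (\<lambda>x. f x + g x) (at x) v" if "x \<in> S" for x
      using fun_cong[OF frechet_derivative_at[OF D[OF that]], of v] .
  qed
  then show ?case using D by (auto intro: differentiableI)
qed

lemma Ck_on_bounded_linear:
  assumes "open S" "bounded_linear L" "Ck_on k f S"
  shows "Ck_on k (\<lambda>x. L (f x)) S"
  using assms(3)
proof (induction k arbitrary: f)
  case 0
  then show ?case using assms(2) by (simp add: bounded_linear.continuous_on)
next
  case (Suc k)
  have D: "((\<lambda>x. L (f x)) has_derivative (\<lambda>v. L (frechet_derivative f (at x) v))) (at x)" if "x \<in> S" for x
    using Suc.prems that
    by (intro bounded_linear.has_derivative[OF assms(2)]) (simp add: frechet_derivative_works[symmetric])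
  have "Ck_on k (\<lambda>x. frechet_derivative (\<lambda>x. L (f x)) (at x) v) S" for v
  proof (rule Ck_on_cong[OF assms(1)])
    show "Ck_on k (\<lambda>x. L (frechet_derivative f (at x) v)) S"
      using Suc.prems by (intro Suc.IH) simp
    show "L (frechet_derivative f (at x) v) = frechet_derivative (\<lambda>x. L (f x)) (at x) v" if "x \<in> S" for x
      using fun_cong[OF frechet_derivative_at[OF D[OF that]], of v] .
  qed
  then show ?case using D by (auto intro: differentiableI)
qed

lemma Ck_on_mult:
  fixes f g :: "_ \<Rightarrow> real"
  assumes "open S" "Ck_on k f S" "Ck_on k g S"
  shows "Ck_on k (\<lambda>x. f x * g x) S"
  using assms(2,3)
proof (induction k arbitrary: f g)
  case 0
  then show ?case by (simp add: continuous_on_mult)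
next
  case (Suc k)
  have D: "((\<lambda>x. f x * g x) has_derivative
      (\<lambda>v. f x * frechet_derivative g (at x) v + frechet_derivative f (at x) v * g x)) (at x)" if "x \<in> S" for x
    using Suc.prems that
    by (intro has_derivative_mult) (simp_all add: frechet_derivative_works[symmetric])
  have "Ck_on k (\<lambda>x. frechet_derivative (\<lambda>x. f x * g x) (at x) v) S" for v
  proof (rule Ck_on_cong[OF assms(1)])
    \<comment> \<open>The product rule involves the undifferentiated factors too, so the induction
      hypothesis needs them at the lower order.\<close>
    have "Ck_on k f S" "Ck_on k g S" using Suc.prems by (auto intro: Ck_on_SucD)
    then show "Ck_on k (\<lambda>x. f x * frechet_derivative g (at x) v + frechet_derivative f (at x) v * g x) S"
      using Suc.prems by (intro Ck_on_add[OF assms(1)] Suc.IH) simp_all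
    show "f x * frechet_derivative g (at x) v + frechet_derivative f (at x) v * g x =
        frechet_derivative (\<lambda>x. f x * g x) (at x) v" if "x \<in> S" for x
      using fun_cong[OF frechet_derivative_at[OF D[OF that]], of v] .
  qed
  then show ?case using D by (auto intro: differentiableI)
qed

lemma smooth_on_cong: "open S \<Longrightarrow> smooth_on f S \<Longrightarrow> (\<And>x. x \<in> S \<Longrightarrow> f x = g x) \<Longrightarrow> smooth_on g S"
  unfolding smooth_on_def using Ck_on_cong[of S f g] by blast

lemma smooth_on_const: "smooth_on (\<lambda>x. c) S"
  unfolding smooth_on_def by (simp add: Ck_on_const)

lemma smooth_on_bounded_linear: "open S \<Longrightarrow> bounded_linear L \<Longrightarrow> smooth_on f S \<Longrightarrow> smooth_on (\<lambda>x. L (f x)) S"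
  unfolding smooth_on_def by (simp add: Ck_on_bounded_linear)

lemma smooth_on_mult:
  fixes f g :: "_ \<Rightarrow> real"
  shows "open S \<Longrightarrow> smooth_on f S \<Longrightarrow> smooth_on g S \<Longrightarrow> smooth_on (\<lambda>x. f x * g x) S"
  unfolding smooth_on_def by (simp add: Ck_on_mult)

lemma smooth_on_sum:
  assumes "open S" "\<And>i. i \<in> I \<Longrightarrow> smooth_on (f i) S"
  shows "smooth_on (\<lambda>x. \<Sum>i\<in>I. f i x) S"
  using assms(2)
proof (induction I rule: infinite_finite_induct)
  case (insert i I)
  then show ?case unfolding smooth_on_def by (simp add: Ck_on_add[OF assms(1)])
qed (simp_all add: smooth_on_const)

lemma smooth_on_prod:
  fixes f :: "_ \<Rightarrow> _ \<Rightarrow> real"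
  assumes "open S" "\<And>i. i \<in> I \<Longrightarrow> smooth_on (f i) S"
  shows "smooth_on (\<lambda>x. \<Prod>i\<in>I. f i x) S"
  using assms(2)
proof (induction I rule: infinite_finite_induct)
  case (insert i I)
  then show ?case by (simp add: smooth_on_mult[OF assms(1)])
qed (simp_all add: smooth_on_const)

lemma smooth_on_imp_continuous_on: "smooth_on f S \<Longrightarrow> continuous_on S f"
  unfolding smooth_on_def by (metis Ck_on.simps(1))

lemma smooth_on_imp_differentiable: "smooth_on f S \<Longrightarrow> x \<in> S \<Longrightarrow> f differentiable (at x)"
  unfolding smooth_on_def by (metis Ck_on.simps(2))

text \<open>The permutation sum is a polynomial in the entries of the matrix.\<close>

lemma smooth_on_pairing_sum:
  assumes "open S" "\<And>i j. i < 2 * k \<Longrightarrow> j < 2 * k \<Longrightarrow> smooth_on (\<lambda>y. M y i j) S"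
  shows "smooth_on (\<lambda>y. pairing_sum k (M y)) S"
  unfolding pairing_sum_def
proof (intro smooth_on_sum[OF assms(1)] smooth_on_mult[OF assms(1)] smooth_on_prod[OF assms(1)] smooth_on_const assms(2))
  fix \<sigma> i assume "\<sigma> \<in> {\<sigma>. \<sigma> permutes {..<2 * k}}" "i \<in> {..<k}"
  then show "\<sigma> (2 * i) < 2 * k" "\<sigma> (2 * i + 1) < 2 * k"
    using permutes_in_image[of \<sigma> "{..<2 * k}"] by auto
qed

lemma ordered_basis_linear_image:
  assumes L: "linear L" "inj L" and bs: "ordered_basis V bs"
  shows "ordered_basis (L ` V) (map L bs)"
proof -
  have "distinct (map L bs)" using bs L(2) by (simp add: ordered_basis_def distinct_map inj_on_def)
  moreover have "independent (L ` set bs)"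
    using bs L by (intro linear_independent_injective_image)
      (auto simp: ordered_basis_def intro: inj_on_subset)
  moreover have "span (L ` set bs) = L ` V"
    using bs linear_span_image[OF L(1)] by (simp add: ordered_basis_def)
  ultimately show ?thesis by (simp add: ordered_basis_def)
qed

section \<open>Coordinate changes and tangent spaces\<close>

context smooth_manifold
begin

lemma open_chart_image:
  assumes "c \<in> A"
  shows "open (snd c ` fst c)"
  using charts[OF assms] by (simp add: is_chart_def)

lemma inj_on_chart: "c \<in> A \<Longrightarrow> inj_on (snd c) (fst c)"
proof -
  assume "c \<in> A"
  then have "openin X (fst c)" "homeomorphic_map (subtopology X (fst c)) (top_of_set (snd c ` fst c)) (snd c)"
    using charts by (auto simp: is_chart_def)
  moreover have "topspace (subtopology X (fst c)) = fst c"
    using \<open>openin X (fst c)\<close> openin_subset by (auto simp: topspace_subtopology)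
  ultimately show ?thesis using homeomorphic_imp_injective_map by metis
qed

lemma chart_inv_chart [simp]: "c \<in> A \<Longrightarrow> p \<in> fst c \<Longrightarrow> chart_inv c (snd c p) = p"
  by (simp add: chart_inv_def inj_on_chart)

lemma open_chart_overlap:
  assumes "c \<in> A" "c' \<in> A"
  shows "open (snd c ` (fst c \<inter> fst c'))"
proof -
  have c: "openin X (fst c)" "homeomorphic_map (subtopology X (fst c)) (top_of_set (snd c ` fst c)) (snd c)"
    "openin X (fst c')"
    using charts assms by (auto simp: is_chart_def)
  have "openin (subtopology X (fst c)) (fst c \<inter> fst c')"
    using c(3) by (auto simp: openin_subtopology)
  then have "openin (top_of_set (snd c ` fst c)) (snd c ` (fst c \<inter> fst c'))"
    using homeomorphic_imp_open_map[OF c(2)] by (auto simp: open_map_def)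
  then show ?thesis using open_chart_image[OF assms(1)] openin_open_trans by blast
qed

lemma transition_has_derivative:
  assumes "c \<in> A" "c' \<in> A" "p \<in> fst c" "p \<in> fst c'"
  shows "((snd c' \<circ> chart_inv c) has_derivative transition_deriv p c c') (at (snd c p))"
proof -
  have "(snd c' \<circ> chart_inv c) differentiable (at (snd c p))"
    using assms by (intro smooth_on_imp_differentiable[OF compatible[OF assms(1,2)]]) auto
  then show ?thesis by (simp add: transition_deriv_def frechet_derivative_works)
qed

lemma linear_transition_deriv:
  "c \<in> A \<Longrightarrow> c' \<in> A \<Longrightarrow> p \<in> fst c \<Longrightarrow> p \<in> fst c' \<Longrightarrow> linear (transition_deriv p c c')"
  by (rule has_derivative_linear[OF transition_has_derivative])

lemma transition_deriv_refl:
  assumes "c \<in> A" "p \<in> fst c"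
  shows "transition_deriv p c c = id"
proof -
  have "((snd c \<circ> chart_inv c) has_derivative id) (at (snd c p))"
    by (rule has_derivative_transform_within_open[OF has_derivative_id[unfolded id_def[symmetric]] open_chart_image[OF assms(1)]])
      (use assms in auto)
  then show ?thesis
    using has_derivative_unique[OF transition_has_derivative[OF assms(1,1,2,2)]] by blast
qed

text \<open>The chain rule. The composed coordinate change agrees with the direct one only on the
  overlap of \<open>c\<close> and \<open>c'\<close>, whose image is open, and that determines the
  derivative.\<close>

lemma transition_deriv_trans:
  assumes "c \<in> A" "c' \<in> A" "c'' \<in> A" "p \<in> fst c" "p \<in> fst c'" "p \<in> fst c''"
  shows "transition_deriv p c c'' = transition_deriv p c' c'' \<circ> transition_deriv p c c'"
proof -
  have "(snd c' \<circ> chart_inv c) (snd c p) = snd c' p" using assms by simp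
  then have "((snd c'' \<circ> chart_inv c') \<circ> (snd c' \<circ> chart_inv c) has_derivative
      transition_deriv p c' c'' \<circ> transition_deriv p c c') (at (snd c p))"
    using transition_has_derivative[OF assms(1,2,4,5)] transition_has_derivative[OF assms(2,3,5,6)]
    by (intro diff_chain_at) simp_all
  then have "((snd c'' \<circ> chart_inv c) has_derivative
      transition_deriv p c' c'' \<circ> transition_deriv p c c') (at (snd c p))"
    by (rule has_derivative_transform_within_open[OF _ open_chart_overlap[OF assms(1,2)]])
      (use assms in auto)
  then show ?thesis
    using has_derivative_unique[OF transition_has_derivative[OF assms(1,3,4,6)]] by blast
qed

lemma tangent_spaceI:
  assumes "\<And>c c'. c \<in> A \<Longrightarrow> c' \<in> A \<Longrightarrow> p \<in> fst c \<Longrightarrow> p \<in> fst c' \<Longrightarrow> v c' = transition_deriv p c c' (v c)"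
    and "\<And>c. c \<notin> A \<or> p \<notin> fst c \<Longrightarrow> v c = 0"
  shows "v \<in> tangent_space A p"
  using assms unfolding tangent_space_def by blast

lemma tangent_spaceD:
  assumes "v \<in> tangent_space A p"
  shows "c \<in> A \<Longrightarrow> c' \<in> A \<Longrightarrow> p \<in> fst c \<Longrightarrow> p \<in> fst c' \<Longrightarrow> v c' = transition_deriv p c c' (v c)"
    and "c \<notin> A \<or> p \<notin> fst c \<Longrightarrow> v c = 0"
  using assms unfolding tangent_space_def by blast+

lemma subspace_tangent_space: "subspace (tangent_space A p)"
proof (rule subspaceI)
  show "0 \<in> tangent_space A p"
    by (rule tangent_spaceI) (simp_all add: linear_0[OF linear_transition_deriv])
next
  fix v w assume vw: "v \<in> tangent_space A p" "w \<in> tangent_space A p"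
  show "v + w \<in> tangent_space A p"
    by (rule tangent_spaceI)
      (simp_all add: linear_add[OF linear_transition_deriv] tangent_spaceD(1)[OF vw(1), symmetric] tangent_spaceD(2)[OF vw(1)] tangent_spaceD(1)[OF vw(2), symmetric] tangent_spaceD(2)[OF vw(2)])
next
  fix a :: real and v assume v: "v \<in> tangent_space A p"
  show "a *\<^sub>R v \<in> tangent_space A p"
    by (rule tangent_spaceI)
      (simp_all add: scaleR_fun_def linear_scale[OF linear_transition_deriv] tangent_spaceD(1)[OF v, symmetric] tangent_spaceD(2)[OF v])
qed

context
  fixes c p assumes c: "c \<in> A" "p \<in> fst c"
begin

lemma coord_vec_self [simp]: "coord_vec A c p w c = w"
  using c by (simp add: coord_vec_def transition_deriv_refl)

text \<open>Compatibility of the components in two further charts is the cocycle identity of the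
  Jacobians.\<close>

lemma coord_vec_in_tangent_space: "coord_vec A c p w \<in> tangent_space A p"
proof (rule tangent_spaceI)
  fix c' c'' assume "c' \<in> A" "c'' \<in> A" "p \<in> fst c'" "p \<in> fst c''"
  then show "coord_vec A c p w c'' = transition_deriv p c' c'' (coord_vec A c p w c')"
    using transition_deriv_trans[OF c(1) \<open>c' \<in> A\<close> \<open>c'' \<in> A\<close> c(2)] by (simp add: coord_vec_def)
qed (auto simp: coord_vec_def)

lemma coord_vec_tangent: "v \<in> tangent_space A p \<Longrightarrow> coord_vec A c p (v c) = v"
  using c by (intro ext) (simp add: coord_vec_def tangent_spaceD(1)[symmetric] tangent_spaceD(2))

lemma linear_coord_vec: "linear (coord_vec A c p)"
  by (rule linearI)
    (auto simp: coord_vec_def fun_eq_iff scaleR_fun_def linear_add[OF linear_transition_deriv]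
      linear_scale[OF linear_transition_deriv] c)

lemma inj_coord_vec: "inj (coord_vec A c p)"
  by (metis coord_vec_self injI)

lemma range_coord_vec: "range (coord_vec A c p) = tangent_space A p"
  using coord_vec_in_tangent_space coord_vec_tangent by (metis (no_types, lifting) UNIV_I image_iff subsetI subset_antisym)

text \<open>In a chart the model space is mapped isomorphically to the tangent space, with the
  component at \<open>c\<close> as inverse, so frames carry over.\<close>

lemma ordered_basis_coord_vec:
  "ordered_basis UNIV ws \<Longrightarrow> ordered_basis (tangent_space A p) (map (coord_vec A c p) ws)"
  using ordered_basis_linear_image[OF linear_coord_vec inj_coord_vec] range_coord_vec by metis

end

end

lemma ordered_basis_Basis: "\<exists>bs :: 'e::euclidean_space list. ordered_basis UNIV bs \<and> length bs = DIM('e)"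
proof -
  obtain bs :: "'e list" where bs: "set bs = Basis" "distinct bs"
    using finite_distinct_list[OF finite_Basis] by blast
  then show ?thesis
    using distinct_card[OF bs(2)] by (auto simp: ordered_basis_def independent_Basis)
qed

section \<open>The Kaehler powers on an almost hermitian manifold\<close>

context almost_hermitian_manifold
begin

text \<open>At each point the manifold axioms restrict to those of the linear algebra locale, so the
  inequality and its equality case can be instantiated at every \<open>p\<close>.\<close>

lemma hermitian_space_tangent:
  assumes "p \<in> topspace X"
  shows "hermitian_space (tangent_space A p) (g p) (J p)"
  by unfold_locales
    (use assms in \<open>auto simp: subspace_tangent_space metric_linear metric_sym metric_pos J_closed J_linear
      J_squared hermitian\<close>)

lemma kaehler_power_eq:
  assumes "p \<in> topspace X"
  shows "kaehler_power g J k p = hermitian_space.kaehler_pow (g p) (J p) k"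
proof -
  interpret hermitian_space "tangent_space A p" "g p" "J p" by (rule hermitian_space_tangent[OF assms])
  have "kaehler_form g J p = kaehler" by (intro ext) (simp add: kaehler_form_def kaehler_def)
  then show ?thesis by (intro ext) (simp add: kaehler_power_def kaehler_pow_def divided_power_def)
qed

text \<open>Smoothness of the metric is given for vectors with constant coordinates, while the
  coordinates of \<open>J w\<close> vary with the point. Expanding them in the standard basis gives
  a finite sum of products of smooth coordinates of \<open>J w\<close> and smooth metric
  coefficients.\<close>

lemma smooth_kaehler_form:
  assumes "c \<in> A"
  shows "smooth_on (\<lambda>y. g (chart_inv c y) (coord_vec A c (chart_inv c y) u)
     (J (chart_inv c y) (coord_vec A c (chart_inv c y) w))) (snd c ` fst c)" (is "smooth_on ?F ?U")
proof -
  have U: "open ?U" by (rule open_chart_image[OF assms])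
  let ?J = "\<lambda>y. J (chart_inv c y) (coord_vec A c (chart_inv c y) w) c"
  let ?g = "\<lambda>y b. g (chart_inv c y) (coord_vec A c (chart_inv c y) u) (coord_vec A c (chart_inv c y) b)"
  have "smooth_on (\<lambda>y. \<Sum>b\<in>Basis. (?J y \<bullet> b) * ?g y b) ?U"
    by (intro smooth_on_sum[OF U] smooth_on_mult[OF U] metric_smooth[OF assms]
        smooth_on_bounded_linear[OF U bounded_linear_inner_left J_smooth[OF assms]])
  moreover have "(\<Sum>b\<in>Basis. (?J y \<bullet> b) * ?g y b) = ?F y" if y: "y \<in> ?U" for y
  proof -
    obtain p where p: "p \<in> fst c" "y = snd c p" using y by blast
    then have inv: "chart_inv c y = p" using assms by simp
    have pX: "p \<in> topspace X" using assms p cover by blast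
    interpret hermitian_space "tangent_space A p" "g p" "J p" by (rule hermitian_space_tangent[OF pX])
    let ?e = "coord_vec A c p"
    have e: "?e v \<in> tangent_space A p" for v by (rule coord_vec_in_tangent_space[OF assms p(1)])
    have "J p (?e w) = ?e (J p (?e w) c)"
      using coord_vec_tangent[OF assms p(1) J_closed[OF e]] by simp
    also have "\<dots> = ?e (\<Sum>b\<in>Basis. (J p (?e w) c \<bullet> b) *\<^sub>R b)"
      by (simp add: euclidean_representation)
    also have "\<dots> = (\<Sum>b\<in>Basis. (J p (?e w) c \<bullet> b) *\<^sub>R ?e b)"
      using linear_coord_vec[OF assms p(1)] by (simp add: linear_sum linear_scale)
    finally have "g p (?e u) (J p (?e w)) = g p (?e u) (\<Sum>b\<in>Basis. (J p (?e w) c \<bullet> b) *\<^sub>R ?e b)" by simp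
    also have "\<dots> = (\<Sum>b\<in>Basis. (J p (?e w) c \<bullet> b) * g p (?e u) (?e b))"
      by (rule h_sum_right) (use e in auto)
    finally show ?thesis by (simp add: inv)
  qed
  ultimately show ?thesis by (rule smooth_on_cong[OF U])
qed

lemma smooth_kaehler_power:
  assumes "c \<in> A" "length ws = 2 * k"
  shows "smooth_on (\<lambda>y. kaehler_power g J k (chart_inv c y) (map (coord_vec A c (chart_inv c y)) ws)) (snd c ` fst c)"
proof -
  have U: "open (snd c ` fst c)" by (rule open_chart_image[OF assms(1)])
  let ?M = "\<lambda>y i j. kaehler_form g J (chart_inv c y) [map (coord_vec A c (chart_inv c y)) ws ! i,
      map (coord_vec A c (chart_inv c y)) ws ! j]"
  have "smooth_on (\<lambda>y. ?M y i j) (snd c ` fst c)" if "i < 2 * k" "j < 2 * k" for i j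
    using smooth_kaehler_form[OF assms(1), of "ws ! i" "ws ! j"] that assms(2) by (simp add: kaehler_form_def)
  then have "smooth_on (\<lambda>y. pairing_sum k (?M y)) (snd c ` fst c)"
    by (rule smooth_on_pairing_sum[OF U])
  then have "smooth_on (\<lambda>y. (1 / (2 ^ k * fact k)) * pairing_sum k (?M y)) (snd c ` fst c)"
    by (intro smooth_on_mult[OF U] smooth_on_const)
  then show ?thesis
    by (simp add: kaehler_power_def wedge_power_two_form)
qed

lemma differential_form_kaehler_power: "differential_form X A (2 * k) (kaehler_power g J k)"
  unfolding differential_form_def
proof (intro conjI ballI allI impI)
  fix p assume p: "p \<in> topspace X"
  show "alternating_form (tangent_space A p) (2 * k) (kaehler_power g J k p)"
    using hermitian_space.alternating_form_kaehler_pow[OF hermitian_space_tangent[OF p]] kaehler_power_eq[OF p] by simp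
qed (rule smooth_kaehler_power)

lemma tangent_space_ordered_basis:
  assumes "p \<in> topspace X"
  shows "\<exists>bs. ordered_basis (tangent_space A p) bs \<and> length bs = DIM('e)"
proof -
  obtain c where c: "c \<in> A" "p \<in> fst c" using assms cover by blast
  then show ?thesis using ordered_basis_Basis[where 'e = 'e] ordered_basis_coord_vec[OF c] by (metis length_map)
qed

text \<open>Applied to the whole tangent space, where \<open>\<Omega>^n\<close> is of top degree,
  the sign criterion turns membership of a frame in the orientation into positivity of a scalar
  function.\<close>

lemma complex_orientation_tangent:
  assumes p: "p \<in> topspace X" and dim: "DIM('e) = 2 * n"
  shows "complex_orientation (J p) (tangent_space A p) =
    {cs. ordered_basis (tangent_space A p) cs \<and> kaehler_power g J n p cs > 0}"
proof -
  interpret hermitian_space "tangent_space A p" "g p" "J p" by (rule hermitian_space_tangent[OF p])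
  obtain bs where "ordered_basis (tangent_space A p) bs" "length bs = 2 * n"
    using tangent_space_ordered_basis[OF p] dim by auto
  then show ?thesis
    using complex_orientation_eq[of "tangent_space A p" bs n] J_closed kaehler_power_eq[OF p] by auto
qed

lemma complex_orientation_pointwise:
  assumes p: "p \<in> topspace X"
  shows "\<exists>bs. ordered_basis (tangent_space A p) bs \<and>
    complex_orientation (J p) (tangent_space A p) = orientation_of bs"
proof -
  interpret hermitian_space "tangent_space A p" "g p" "J p" by (rule hermitian_space_tangent[OF p])
  let ?T = "tangent_space A p"
  have inv: "J p ` ?T \<subseteq> ?T" using J_closed by blast
  obtain bs where bs: "ordered_basis ?T bs" using tangent_space_ordered_basis[OF p] by blast
  obtain es where es: "orthonormal (g p) (complex_flat (J p) es)" "ordered_basis ?T (complex_flat (J p) es)"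
    "complex_basis (J p) ?T es" "2 * length es = length bs" "kaehler_pow (length es) (complex_flat (J p) es) = 1"
    by (rule unitary_basis_exists[OF bs subset_refl inv])
  have len: "length (complex_flat (J p) es) = 2 * length es" by (rule length_complex_flat)
  have "orientation_of (complex_flat (J p) es) = {cs. ordered_basis ?T cs \<and> kaehler_pow (length es) cs > 0}"
    using es(5) by (intro orientation_of_form[OF subspace_T alternating_form_kaehler_pow es(2) subset_refl len]) simp
  then show ?thesis using complex_orientation_eq[OF es(2) subset_refl inv len] es(2) by blast
qed

text \<open>The set in question is the preimage, under the chart, of the positive set of the top
  Kaehler power evaluated on the frame, which is continuous in coordinates because it is smooth
  there.\<close>

lemma openin_complex_orientation:
  assumes c: "c \<in> A" and ws: "ordered_basis UNIV ws" and dim: "DIM('e) = 2 * n"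
  shows "openin X {p \<in> fst c. map (coord_vec A c p) ws \<in> complex_orientation (J p) (tangent_space A p)}"
proof -
  let ?U = "snd c ` fst c"
  define F where "F y = kaehler_power g J n (chart_inv c y) (map (coord_vec A c (chart_inv c y)) ws)" for y
  have len: "length ws = 2 * n" using ordered_basis_length[OF ws] dim by simp
  have ch: "openin X (fst c)" "homeomorphic_map (subtopology X (fst c)) (top_of_set ?U) (snd c)"
    using charts[OF c] by (auto simp: is_chart_def)
  have "continuous_on ?U F"
    unfolding F_def by (rule smooth_on_imp_continuous_on[OF smooth_kaehler_power[OF c len]])
  then have "openin (top_of_set ?U) (?U \<inter> F -` {0<..})"
    by (rule continuous_openin_preimage_gen) simp
  moreover have "continuous_map (subtopology X (fst c)) (top_of_set ?U) (snd c)"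
    using ch(2) by (rule homeomorphic_imp_continuous_map)
  ultimately have "openin (subtopology X (fst c)) {p \<in> topspace (subtopology X (fst c)). snd c p \<in> ?U \<inter> F -` {0<..}}"
    by (simp only: openin_continuous_map_preimage)
  moreover have "{p \<in> topspace (subtopology X (fst c)). snd c p \<in> ?U \<inter> F -` {0<..}} =
      {p \<in> fst c. map (coord_vec A c p) ws \<in> complex_orientation (J p) (tangent_space A p)}"
  proof -
    have top: "topspace (subtopology X (fst c)) = fst c"
      using openin_subset[OF ch(1)] by auto
    have "map (coord_vec A c p) ws \<in> complex_orientation (J p) (tangent_space A p) \<longleftrightarrow> F (snd c p) > 0"
      if p: "p \<in> fst c" for p
    proof -
      have "p \<in> topspace X" using p c cover by blast
      then show ?thesis
        using complex_orientation_tangent[OF _ dim, of p] ordered_basis_coord_vec[OF c p ws] p c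
        by (simp add: F_def)
    qed
    then show ?thesis unfolding top by auto
  qed
  ultimately show ?thesis using openin_trans_full[OF _ ch(1)] by simp
qed

lemma oriented_riemannian_manifold_complex_orientation:
  assumes "DIM('e) = 2 * n"
  shows "oriented_riemannian_manifold X A g (\<lambda>p. complex_orientation (J p) (tangent_space A p))"
  by unfold_locales (auto intro: complex_orientation_pointwise openin_complex_orientation assms)

end

text \<open>For \<open>k > n\<close> there are neither \<open>2 * k\<close>-planes nor complex
  subspaces of dimension \<open>k\<close>, and the contact set equation reads as an equality of
  empty sets.\<close>

theorem proposition1:
  fixes X :: "'a topology" and A :: "('a, 'e::euclidean_space) chart set"
    and g :: "'a \<Rightarrow> ('a, 'e) tvec \<Rightarrow> ('a, 'e) tvec \<Rightarrow> real"
    and J :: "'a \<Rightarrow> ('a, 'e) tvec \<Rightarrow> ('a, 'e) tvec"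
    and n k :: nat
  assumes "almost_hermitian_manifold X A g J"
    and "DIM('e) = 2 * n"
  shows "generalized_calibration X A g (\<lambda>p. complex_orientation (J p) (tangent_space A p))
           (2 * k) (kaehler_power g J k) \<and>
         (\<forall>p\<in>topspace X.
            contact_set A g (2 * k) (kaehler_power g J k) p =
              (\<lambda>V. (V, complex_orientation (J p) V)) `
                complex_grassmannian (J p) (tangent_space A p) k)"
proof -
  interpret almost_hermitian_manifold X A g J by fact
  have "plane_value (g p) (kaehler_power g J k p) \<xi> \<le> 1"
    if "p \<in> topspace X" "\<xi> \<in> oriented_planes (tangent_space A p) (2 * k)" for p \<xi>
    using hermitian_space.plane_value_kaehler_le_1[OF hermitian_space_tangent[OF that(1)] that(2)]
      kaehler_power_eq[OF that(1)] by simp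
  moreover have "contact_set A g (2 * k) (kaehler_power g J k) p =
      (\<lambda>V. (V, complex_orientation (J p) V)) ` complex_grassmannian (J p) (tangent_space A p) k"
    if "p \<in> topspace X" for p
    using hermitian_space.contact_planes[OF hermitian_space_tangent[OF that]] kaehler_power_eq[OF that]
    by (simp add: contact_set_def)
  ultimately show ?thesis
    using oriented_riemannian_manifold_complex_orientation[OF assms(2)] differential_form_kaehler_power
    by (simp add: generalized_calibration_def)
qed

end
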